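(* Let $n\ge 2$, $s_1,s_2\in(0,1)$, $\lambda\ge1$, $\varrho\in(0,\infty]$, $\sigma\in\mathbb{R}$, $K_1\in\mathbf{K}(n,s_1,\lambda,\varrho)$ and $K_2\in\mathbf{K}(n,s_2,\lambda,\varrho)$. Let $\Omega\subseteq\mathbb{R}^n$ be an open and bounded set with $I_1(\Omega,\Omega^c)+I_2(\Omega,\Omega^c)<+\infty$. Let $m\in(0,|\Omega|)$ and $g\in L^\infty(\Omega)$. Then there exists a minimizer of the functional $\mathcal{C}$ among all (measurable) sets $E\subseteq\Omega$ with Lebesgue measure $|E|=m$. Moreover, $I_1(E,E^c\cap\Omega)<+\infty$ for every such minimizer $E$.
   Context: For $n\ge2$, $s\in(0,1)$, $\lambda\ge1$, $\varrho\in(0,\infty]$, $\mathbf{K}(n,s,\lambda,\varrho)$ is the family of even (measurable) functions $K:\mathbb{R}^n\setminus\{0\}\to[0,+\infty)$ such that for all $\zeta\in\mathbb{R}^n\setminus\{0\}$ $$\frac{\chi_{B_\varrho}(\zeta)}{\lambda|\zeta|^{n+s}}\le K(\zeta)\le\frac{\lambda}{|\zeta|^{n+s}},$$ with $B_\varrho$ the ball of radius $\varrho$ centered at $0$ and $B_\varrho=\mathbb{R}^n$ if $\varrho=\infty$. For disjoint measurable sets $E,F\subseteq\mathbb{R}^n$ and $i\in\{1,2\}$, $I_i(E,F):=\int_E\int_F K_i(x-y)\,dx\,dy$. Complements are $E^c:=\mathbb{R}^n\setminus E$. For $E\subseteq\Omega$: $\mathcal{E}(E):=I_1(E,E^c\cap\Omega)+\sigma\,I_2(E,\Omega^c)$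 and $\mathcal{C}(E):=\mathcal{E}(E)+\int_E g(x)\,dx$. *)

theory Defs
  imports "HOL-Analysis.Analysis"
begin

text \<open>Radii range over \<open>(0, \<infinity>]\<close>; for \<open>\<rho> = \<infinity>\<close> the ball is the whole space.\<close>

definition centered_ball :: "ereal \<Rightarrow> (real ^ 'n) set" where
  "centered_ball \<rho> = {z. ereal (norm z) < \<rho>}"

text \<open>Kernels live on the punctured space; the totalised value \<open>K 0\<close> is left unconstrained.
  Measurability is in the sense of Lebesgue, and the dimension is \<open>CARD('n)\<close>.\<close>

definition kernel_class :: "real \<Rightarrow> real \<Rightarrow> ereal \<Rightarrow> (real ^ 'n \<Rightarrow> real) set" where
  "kernel_class s lam \<rho> = {K.
     K \<in> borel_measurable (lebesgue_on (UNIV - {0})) \<and>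
     (\<forall>z. z \<noteq> 0 \<longrightarrow> K (- z) = K z) \<and>
     (\<forall>z. z \<noteq> 0 \<longrightarrow> 0 \<le> K z) \<and>
     (\<forall>z. z \<noteq> 0 \<longrightarrow>
        indicator (centered_ball \<rho>) z / (lam * norm z powr (real CARD('n) + s)) \<le> K z \<and>
        K z \<le> lam / norm z powr (real CARD('n) + s))}"

text \<open>Only used for disjoint \<open>E\<close> and \<open>F\<close>, so that \<open>K 0\<close> does not enter.\<close>

definition interaction ::
  "(real ^ 'n \<Rightarrow> real) \<Rightarrow> (real ^ 'n) set \<Rightarrow> (real ^ 'n) set \<Rightarrow> ennreal" where
  "interaction K E F =
     (\<integral>\<^sup>+x\<in>E. (\<integral>\<^sup>+y\<in>F. ennreal (K (x - y)) \<partial>lebesgue) \<partial>lebesgue)"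

text \<open>The energies are extended-real valued: the first interaction may be infinite.  The sum is
  unambiguous whenever \<open>interaction K2 E (- \<Omega>)\<close> is finite, which holds for \<open>E \<subseteq> \<Omega>\<close> as soon as
  \<open>interaction K2 \<Omega> (- \<Omega>)\<close> is finite.\<close>

definition capillarity_energy ::
  "(real ^ 'n \<Rightarrow> real) \<Rightarrow> (real ^ 'n \<Rightarrow> real) \<Rightarrow> real \<Rightarrow> (real ^ 'n) set \<Rightarrow> (real ^ 'n) set \<Rightarrow> ereal"
  where
  "capillarity_energy K1 K2 \<sigma> \<Omega> E =
     enn2ereal (interaction K1 E (- E \<inter> \<Omega>)) + ereal \<sigma> * enn2ereal (interaction K2 E (- \<Omega>))"

definition capillarity_functional ::
  "(real ^ 'n \<Rightarrow> real) \<Rightarrow> (real ^ 'n \<Rightarrow> real) \<Rightarrow> real \<Rightarrow> (real ^ 'n \<Rightarrow> real) \<Rightarrow>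
   (real ^ 'n) set \<Rightarrow> (real ^ 'n) set \<Rightarrow> ereal"
  where
  "capillarity_functional K1 K2 \<sigma> g \<Omega> E =
     capillarity_energy K1 K2 \<sigma> \<Omega> E + ereal (LINT x:E|lebesgue. g x)"

definition L_infinity :: "(real ^ 'n) set \<Rightarrow> (real ^ 'n \<Rightarrow> real) set" where
  "L_infinity \<Omega> = {g. g \<in> borel_measurable (lebesgue_on \<Omega>) \<and>
     (\<exists>M. AE x in lebesgue_on \<Omega>. \<bar>g x\<bar> \<le> M)}"

definition admissible_sets :: "(real ^ 'n) set \<Rightarrow> real \<Rightarrow> (real ^ 'n) set set" where
  "admissible_sets \<Omega> m = {E. E \<in> sets lebesgue \<and> E \<subseteq> \<Omega> \<and> emeasure lebesgue E = ennreal m}"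

definition is_volume_minimizer ::
  "((real ^ 'n) set \<Rightarrow> ereal) \<Rightarrow> (real ^ 'n) set \<Rightarrow> real \<Rightarrow> (real ^ 'n) set \<Rightarrow> bool" where
  "is_volume_minimizer J \<Omega> m E \<longleftrightarrow>
     E \<in> admissible_sets \<Omega> m \<and> (\<forall>F \<in> admissible_sets \<Omega> m. J E \<le> J F)"

end

theory Submission
  imports Defs "HOL-Library.Diagonal_Subsequence"
begin

text \<open>
  The proof is the direct method of the calculus of variations: a minimizing sequence of sets has a
  subsequence whose indicators converge almost everywhere, and the functional does not increase in
  the limit.

  \<^emph>\<open>Competitor.\<close>  The infimum is below \<open>\<infinity>\<close> because some admissible set has finite energy.  Cutting
  \<open>\<Omega>\<close> by a half-space \<open>x $ i < t\<close> realises every volume between \<open>0\<close> and \<open>|\<Omega>|\<close>.  Substituting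
  \<open>z = x - y\<close>, a jump of length \<open>|z|\<close> crosses the hyperplane only from a slab of thickness at most
  \<open>|z|\<close>, so the energy of the cut is bounded by the integral of \<open>|z| powr (1 - n - s)\<close> over a ball,
  which converges since \<open>s < 1\<close> (\<open>halfspace_energy_finite\<close>).

  \<^emph>\<open>Compactness.\<close>  Since \<open>\<Omega>\<close> has finite interaction with its complement, a bound on the interaction
  of \<open>E \<subseteq> \<Omega>\<close> with \<open>\<Omega> - E\<close> bounds the full nonlocal perimeter of \<open>E\<close>.
  Between two points of a small dyadic cube, of side \<open>2 powr (- j)\<close>, the kernel is at least a constant
  times \<open>2 powr (j * (n + s))\<close>.  Hence replacing the indicator of \<open>E\<close> by its averages
  over these cubes costs at most a constant times \<open>2 powr (- j * s)\<close> in \<open>L\<^sup>1\<close>, uniformly along the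
  sequence (\<open>cell_average_deviation\<close>, \<open>kernel_bound_on_dyadic_cells\<close>).  There are countably many
  cubes, so a diagonal subsequence makes all averages converge; the indicators are then Cauchy in
  \<open>L\<^sup>1\<close>, and a further subsequence converges almost everywhere
  (\<open>finite_nonlocal_energy_compactness\<close>).

  \<^emph>\<open>Semicontinuity.\<close>  Fatou's lemma handles the first interaction, which may be infinite.  The
  wetting term and the potential term are continuous by dominated convergence, with dominating
  functions given by the finite interaction of \<open>\<Omega>\<close> with its complement and by \<open>|g|\<close>; this works for
  either sign of \<open>\<sigma>\<close>.

  The kernels, and the admissible sets, are only Lebesgue measurable, and \<open>K (x - y)\<close> need not be
  measurable for the product of two Lebesgue measures.  Everything is therefore first transferred to
  Borel representatives, for which Tonelli's theorem applies
  (\<open>interaction_eq_nonlocal_energy\<close>).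
\<close>

section \<open>Borel representatives of kernels and sets\<close>

text \<open>The counterpart of \<open>interaction\<close> for Borel data.  Kernels take extended nonnegative values, so
  that the theorems of Tonelli and Fatou apply directly.\<close>

definition nonlocal_energy :: "('a::euclidean_space \<Rightarrow> ennreal) \<Rightarrow> 'a set \<Rightarrow> 'a set \<Rightarrow> ennreal" where
  "nonlocal_energy k E F =
     (\<integral>\<^sup>+x. (\<integral>\<^sup>+y. k (x - y) * indicator F y \<partial>lborel) * indicator E x \<partial>lborel)"

lemma nn_integral_reflection:
  fixes f :: "'a::euclidean_space \<Rightarrow> ennreal"
  assumes [measurable]: "f \<in> borel_measurable borel"
  shows "(\<integral>\<^sup>+y. f (x - y) \<partial>lborel) = (\<integral>\<^sup>+y. f y \<partial>lborel)"
proof -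
  have "(\<integral>\<^sup>+y. f y \<partial>lborel) =
      (\<integral>\<^sup>+y. f y \<partial>density (distr lborel borel (\<lambda>y. x + (-1) *\<^sub>R y)) (\<lambda>_. \<bar>-1::real\<bar>^DIM('a)))"
    by (subst lborel_affine[of "-1" x, symmetric]) auto
  also have "\<dots> = (\<integral>\<^sup>+y. f (x - y) \<partial>lborel)"
    by (simp add: density_1 nn_integral_distr)
  finally show ?thesis by simp
qed

lemma AE_reflection:
  fixes x :: "'a::euclidean_space"
  assumes "AE z in lborel. P z"
  shows "AE y in lborel. P (x - y)"
proof -
  obtain N where N: "{z. \<not> P z} \<subseteq> N" "N \<in> null_sets lborel"
    using assms by (auto elim!: AE_E simp: null_sets_def)
  have [measurable]: "N \<in> sets borel" using N(2) by auto
  have "(\<integral>\<^sup>+y. indicator N (x - y) \<partial>lborel) = 0"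
    using nn_integral_reflection[of "indicator N" x] N(2) by (simp add: null_setsD1)
  then have "AE y in lborel. indicator N (x - y) = (0::ennreal)"
    by (subst (asm) nn_integral_0_iff_AE) auto
  then show ?thesis
    by eventually_elim (use N(1) in \<open>auto simp: indicator_def split: if_splits\<close>)
qed

text \<open>For each fixed \<open>x\<close> the inner integral depends on the kernel and on the second set only up to null
  sets, since a null set stays null under \<open>y \<mapsto> x - y\<close>.  Comparing the two energies slice by slice
  avoids the joint measurability of \<open>K (x - y)\<close>, which may fail.\<close>

lemma interaction_eq_nonlocal_energy:
  assumes k: "AE z in lborel. ennreal (K z) = k z"
    and E: "AE x in lborel. x \<in> E \<longleftrightarrow> x \<in> E'"
    and F: "AE x in lborel. x \<in> F \<longleftrightarrow> x \<in> F'"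
  shows "interaction K E F = nonlocal_energy k E' F'"
proof -
  have "(\<integral>\<^sup>+y. ennreal (K (x - y)) * indicator F y \<partial>lborel) =
        (\<integral>\<^sup>+y. k (x - y) * indicator F' y \<partial>lborel)" for x
    by (rule nn_integral_cong_AE)
      (use F AE_reflection[OF k, of x] in eventually_elim, auto simp: indicator_def)
  then show ?thesis
    unfolding interaction_def nonlocal_energy_def nn_integral_completion
    by (intro nn_integral_cong_AE)
      (use E in eventually_elim, auto simp: indicator_def)
qed

text \<open>An arbitrary Borel representative satisfies the two kernel bounds only almost everywhere.  Clamping
  it between the two bounds, which are themselves Borel, restores them at every point; at the origin
  both bounds are \<open>0\<close> because division by zero yields zero.\<close>

lemma kernel_class_borel_representative:
  fixes K :: "real ^ 'n \<Rightarrow> real"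
  assumes K: "K \<in> kernel_class s lam \<rho>" and lam: "lam \<ge> 1"
  obtains k where "k \<in> borel_measurable borel" "AE z in lborel. ennreal (K z) = k z"
    "\<And>z. k z \<le> ennreal (lam / norm z powr (real CARD('n) + s))"
    "\<And>z. ereal (norm z) < \<rho> \<Longrightarrow> ennreal (1 / (lam * norm z powr (real CARD('n) + s))) \<le> k z"
proof -
  let ?p = "real CARD('n) + s"
  define lo where "lo z = ennreal (indicator (centered_ball \<rho>) z / (lam * norm z powr ?p))" for z :: "real^'n"
  define up where "up z = ennreal (lam / norm z powr ?p)" for z :: "real^'n"
  have "K \<in> borel_measurable (lebesgue_on (UNIV - {0}))"
    using K by (simp add: kernel_class_def)
  then have "(\<lambda>z. if z \<in> UNIV - {0} then K z else 0) \<in> borel_measurable lebesgue"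
    using borel_measurable_if_I[of K "UNIV - {0}"] by auto
  then have "(\<lambda>z. ennreal (if z \<in> UNIV - {0} then K z else 0)) \<in> borel_measurable lebesgue"
    by measurable
  from completion_ex_borel_measurable[OF this]
  obtain k0 where [measurable]: "k0 \<in> borel_measurable lborel"
    and k0: "AE z in lborel. ennreal (if z \<in> UNIV - {0} then K z else 0) = k0 z" by auto
  have [measurable]: "centered_ball \<rho> \<in> sets borel" "lo \<in> borel_measurable borel" "up \<in> borel_measurable borel"
    unfolding lo_def up_def centered_ball_def by measurable
  have bnds: "lo z \<le> ennreal (K z) \<and> ennreal (K z) \<le> up z" if "z \<noteq> 0" for z
    using K that unfolding kernel_class_def lo_def up_def by (auto intro!: ennreal_leI)
  have lu: "lo z \<le> up z" for z
    using bnds[of z] order_trans by (cases "z = 0") (auto simp: lo_def up_def)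
  define k where "k z = max (lo z) (min (up z) (k0 z))" for z
  show ?thesis
  proof
    show "k \<in> borel_measurable borel" unfolding k_def by measurable
    have "AE z in lborel. z \<noteq> (0::real^'n)" by (rule AE_lborel_singleton)
    then show "AE z in lborel. ennreal (K z) = k z"
      using k0
    proof eventually_elim
      case (elim z)
      then show ?case
        using bnds[of z] lu[of z] by (auto simp: k_def max_def min_def)
    qed
    show "k z \<le> ennreal (lam / norm z powr ?p)" for z
      using lu[of z] by (auto simp: k_def up_def)
    show "ennreal (1 / (lam * norm z powr ?p)) \<le> k z" if "ereal (norm z) < \<rho>" for z
      using that by (auto simp: k_def lo_def centered_ball_def)
  qed
qed

section \<open>A competitor of finite energy\<close>

lemma summable_geometric_powr:
  assumes "a < real n" "D > 0"
  shows "summable (\<lambda>k. (D / 2 ^ Suc k) powr (-a) * (c * (D / 2 ^ k) ^ n))"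
proof -
  have "(D / 2 ^ Suc k) powr (-a) * (c * (D / 2 ^ k) ^ n) =
      ((D / 2) powr (-a) * c * D ^ n) * (2 powr (a - real n)) ^ k" for k
  proof -
    have "(D / 2 ^ Suc k) powr (-a) = (D/2) powr (-a) * (1 / 2 ^ k) powr (-a)"
      using assms by (subst powr_mult[symmetric]) auto
    also have "(1 / (2::real) ^ k) = 2 powr (- real k)"
      by (simp add: powr_minus powr_realpow divide_simps)
    finally have 1: "(D / 2 ^ Suc k) powr (-a) = (D/2) powr (-a) * 2 powr (real k * a)"
      by (simp add: powr_powr)
    have "(D / 2 ^ k) ^ n = D ^ n * 2 powr (- real k * real n)"
      by (simp add: power_divide powr_minus powr_realpow[symmetric] powr_powr power_mult[symmetric] field_simps)
    moreover have "2 powr (real k * a) * 2 powr (- real k * real n) = (2 powr (a - real n)) ^ k"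
      by (simp add: powr_add[symmetric] powr_realpow[symmetric] powr_powr algebra_simps)
    ultimately show ?thesis using 1 by (simp add: mult_ac)
  qed
  then have "(\<lambda>k. (D / 2 ^ Suc k) powr (-a) * (c * (D / 2 ^ k) ^ n)) =
      (\<lambda>k. ((D / 2) powr (-a) * c * D ^ n) * (2 powr (a - real n)) ^ k)"
    by (rule ext)
  moreover have "norm (2 powr (a - real n)) < 1"
    using assms by (simp add: powr_less_one)
  ultimately show ?thesis
    using summable_mult[OF summable_geometric] by metis
qed

text \<open>Covering the ball by the annuli between the radii \<open>D / 2 ^ Suc k\<close> and \<open>D / 2 ^ k\<close>, on each of which the
  integrand is comparable to a constant, reduces the convergence to a geometric series of ratio
  \<open>2 powr (a - n)\<close>.\<close>

lemma nn_integral_norm_powr_finite: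
  fixes D a :: real
  assumes a: "0 \<le> a" "a < real DIM('a::euclidean_space)" and D: "D > 0"
  shows "(\<integral>\<^sup>+z. ennreal (norm z powr (-a)) * indicator (cball 0 D) (z::'a) \<partial>lborel) < \<infinity>"
proof -
  define g where "g k z = ennreal ((D / 2 ^ Suc k) powr (-a)) * indicator (cball 0 (D / 2 ^ k)) (z::'a)" for k z
  have [measurable]: "g k \<in> borel_measurable lborel" for k
    unfolding g_def
    by (intro borel_measurable_times_ennreal borel_measurable_const borel_measurable_indicator) simp
  have dom: "ennreal (norm z powr (-a)) * indicator (cball 0 D) z \<le> (\<Sum>k. g k z)" for z :: 'a
  proof (cases "0 < norm z \<and> norm z \<le> D")
    case True
    obtain j where j: "D / norm z < 2 ^ j"
      using real_arch_pow[of 2 "D / norm z"] by auto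
    \<comment> \<open>The annulus that contains \<open>z\<close>.\<close>
    define k where "k = (LEAST j. D / norm z < 2 ^ Suc j)"
    have "D / norm z < 2 ^ Suc j" using j by (rule less_trans) simp
    then have k1: "D / norm z < 2 ^ Suc k"
      unfolding k_def by (rule LeastI[where P = "\<lambda>j. D / norm z < 2 ^ Suc j"])
    have k2: "norm z \<le> D / 2 ^ k"
    proof (cases k)
      case (Suc l)
      then have "\<not> D / norm z < 2 ^ Suc l"
        using not_less_Least[of l "\<lambda>j. D / norm z < 2 ^ Suc j"] unfolding k_def by linarith
      then show ?thesis using Suc True by (simp add: field_simps)
    qed (use True in auto)
    have "D / 2 ^ Suc k < norm z" using k1 True by (simp add: field_simps)
    then have "norm z powr (-a) \<le> (D / 2 ^ Suc k) powr (-a)"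
      using D a by (intro powr_mono2') auto
    then have "ennreal (norm z powr (-a)) * indicator (cball 0 D) z \<le> g k z"
      using k2 by (auto simp: g_def indicator_def intro!: ennreal_leI)
    also have "g k z \<le> (\<Sum>k. g k z)"
      using sum_le_suminf[of "\<lambda>k. g k z" "{k}"] by (simp add: summableI)
    finally show ?thesis .
  qed (auto simp: indicator_def)
  have g_integral: "(\<lambda>k. \<integral>\<^sup>+z. g k z \<partial>lborel) = (\<lambda>k. ennreal ((D / 2 ^ Suc k) powr (-a) *
        (unit_ball_vol (real DIM('a)) * (D / 2 ^ k) ^ DIM('a))))"
  proof
    fix k
    have "(\<integral>\<^sup>+z. g k z \<partial>lborel) =
        ennreal ((D / 2 ^ Suc k) powr (-a)) * emeasure lborel (cball (0::'a) (D / 2 ^ k))"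
      unfolding g_def by (rule nn_integral_cmult_indicator) simp
    also have "emeasure lborel (cball (0::'a) (D / 2 ^ k)) =
        ennreal (unit_ball_vol (real DIM('a)) * (D / 2 ^ k) ^ DIM('a))"
      using D by (intro emeasure_cball) simp
    finally show "(\<integral>\<^sup>+z. g k z \<partial>lborel) = ennreal ((D / 2 ^ Suc k) powr (-a) *
        (unit_ball_vol (real DIM('a)) * (D / 2 ^ k) ^ DIM('a)))"
      using D by (subst ennreal_mult) (auto simp: unit_ball_vol_nonneg)
  qed
  from dom have "(\<integral>\<^sup>+z. ennreal (norm z powr (-a)) * indicator (cball 0 D) (z::'a) \<partial>lborel)
      \<le> (\<integral>\<^sup>+z. (\<Sum>k. g k z) \<partial>lborel)"
    by (intro nn_integral_mono)
  also have "\<dots> = (\<Sum>k. \<integral>\<^sup>+z. g k z \<partial>lborel)"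
    by (rule nn_integral_suminf) measurable
  also have "\<dots> < \<infinity>"
    unfolding g_integral
    by (subst suminf_ennreal2)
      (use D in \<open>auto intro!: mult_nonneg_nonneg summable_geometric_powr[OF a(2) D] simp del: power_Suc\<close>)
  finally show ?thesis .
qed

lemma emeasure_slab_le:
  fixes i :: "'n::finite"
  assumes "R \<ge> 0" "a \<le> b"
  shows "emeasure lborel {x \<in> cball (0::real^'n) R. a \<le> x $ i \<and> x $ i \<le> b}
           \<le> ennreal ((2 * R) ^ (CARD('n) - 1) * (b - a))"
proof -
  define l u :: "real^'n" where "l = (\<chi> j. if j = i then a else - R)" and "u = (\<chi> j. if j = i then b else R)"
  have ne: "cbox l u \<noteq> {}"
    using assms by (auto simp: l_def u_def interval_ne_empty_cart)
  have "{x \<in> cball (0::real^'n) R. a \<le> x $ i \<and> x $ i \<le> b} \<subseteq> cbox l u"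
  proof safe
    fix x :: "real^'n" assume x: "x \<in> cball 0 R" "a \<le> x $ i" "x $ i \<le> b"
    have "\<bar>x $ j\<bar> \<le> R" for j
      using component_le_norm_cart[of x j] x(1) by simp
    then have "- R \<le> x $ j \<and> x $ j \<le> R" for j by (meson abs_le_iff minus_le_iff)
    then show "x \<in> cbox l u" using x by (auto simp: l_def u_def mem_box_cart)
  qed
  then have "emeasure lborel {x \<in> cball (0::real^'n) R. a \<le> x $ i \<and> x $ i \<le> b} \<le> emeasure lborel (cbox l u)"
    by (rule emeasure_mono) simp
  also have "\<dots> = ennreal (measure lborel (cbox l u))"
    by (rule emeasure_eq_ennreal_measure) (simp add: emeasure_lborel_cbox_eq)
  also have "measure lborel (cbox l u) = (\<Prod>j\<in>UNIV. u $ j - l $ j)"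
    using content_cbox_cart[OF ne] .
  also have "\<dots> = (u $ i - l $ i) * (\<Prod>j\<in>UNIV - {i}. u $ j - l $ j)"
    by (rule prod.remove) auto
  also have "(\<Prod>j\<in>UNIV - {i}. u $ j - l $ j) = (\<Prod>j\<in>UNIV - {i}. 2 * R)"
    by (intro prod.cong) (auto simp: l_def u_def)
  also have "(u $ i - l $ i) * (\<Prod>j\<in>UNIV - {i}. 2 * R) = (2 * R) ^ (CARD('n) - 1) * (b - a)"
    by (simp add: l_def u_def card_Diff_singleton)
  finally show ?thesis .
qed

text \<open>After the substitution \<open>z = x - y\<close> the points \<open>x\<close> of \<open>\<Omega>\<close> that the jump from \<open>x\<close> to \<open>x - z\<close> carries across
  the hyperplane lie in a slab, of measure at most a constant times \<open>|z|\<close>.  This gains one power of \<open>|z|\<close> over the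
  kernel, which makes the singularity integrable when \<open>s < 1\<close>.\<close>

lemma halfspace_energy_finite:
  fixes k :: "real^'n \<Rightarrow> ennreal" and i :: 'n
  assumes [measurable]: "k \<in> borel_measurable borel" "\<Omega> \<in> sets borel"
    and le: "\<And>z. k z \<le> ennreal (lam / norm z powr (real CARD('n) + s))"
    and lam: "lam \<ge> 0" and s: "0 < s" "s < 1" and R: "R > 0" "\<Omega> \<subseteq> cball 0 R"
  shows "nonlocal_energy k {x \<in> \<Omega>. x $ i < t} {x \<in> \<Omega>. \<not> x $ i < t} < \<infinity>"
proof -
  define n where "n = CARD('n)"
  have n: "n \<ge> 1" by (simp add: n_def Suc_leI)
  let ?E = "{x \<in> \<Omega>. x $ i < t}" and ?F = "{x \<in> \<Omega>. \<not> x $ i < t}"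
  define C where "C = (2 * R) ^ (n - 1) * lam"
  have [measurable]: "?E \<in> sets borel" "?F \<in> sets borel" by measurable
  \<comment> \<open>The contribution of the jumps by a fixed vector \<open>z\<close>.\<close>
  have slice: "k z * (\<integral>\<^sup>+x. indicator ?F (x - z) * indicator ?E x \<partial>lborel)
      \<le> ennreal C * (ennreal (norm z powr (-(real n - 1 + s))) * indicator (cball 0 (2 * R)) z)" for z
  proof (cases "z = 0 \<or> (\<forall>x. x \<in> ?E \<longrightarrow> x - z \<notin> ?F)")
    case True
    then have "(\<integral>\<^sup>+x. indicator ?F (x - z) * indicator ?E x \<partial>lborel) = (\<integral>\<^sup>+(x::real^'n). 0 \<partial>lborel)"
      by (intro nn_integral_cong) (auto simp: indicator_def)
    then show ?thesis by simp
  next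
    case False
    then obtain x0 where z: "z \<noteq> 0" and x0: "x0 \<in> ?E" "x0 - z \<in> ?F" by auto
    have "norm z = norm (x0 - (x0 - z))" by simp
    also have "\<dots> \<le> norm x0 + norm (x0 - z)" by (rule norm_triangle_ineq4)
    also have "\<dots> \<le> R + R" using x0 R(2) by (intro add_mono) (auto simp: subset_iff)
    also have "\<dots> = 2 * R" by simp
    finally have zR: "z \<in> cball 0 (2 * R)" by simp
    have "(\<integral>\<^sup>+x. indicator ?F (x - z) * indicator ?E x \<partial>lborel)
        \<le> (\<integral>\<^sup>+x. indicator {x \<in> cball 0 R. t - norm z \<le> x $ i \<and> x $ i \<le> t} x \<partial>lborel)"
    proof (rule nn_integral_mono)
      fix x
      have "\<bar>z $ i\<bar> \<le> norm z" by (rule component_le_norm_cart)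
      then show "indicator ?F (x - z) * indicator ?E x
         \<le> (indicator {x \<in> cball 0 R. t - norm z \<le> x $ i \<and> x $ i \<le> t} x :: ennreal)"
        using R by (auto simp: indicator_def subset_iff)
    qed
    also have "\<dots> = emeasure lborel {x \<in> cball (0::real^'n) R. t - norm z \<le> x $ i \<and> x $ i \<le> t}"
      by (rule nn_integral_indicator) measurable
    also have "\<dots> \<le> ennreal ((2 * R) ^ (n - 1) * (t - (t - norm z)))"
      unfolding n_def using R by (intro emeasure_slab_le) auto
    finally have 1: "(\<integral>\<^sup>+x. indicator ?F (x - z) * indicator ?E x \<partial>lborel) \<le> ennreal ((2 * R) ^ (n - 1) * norm z)"
      by simp
    have "k z * (\<integral>\<^sup>+x. indicator ?F (x - z) * indicator ?E x \<partial>lborel)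
        \<le> ennreal (lam / norm z powr (real n + s)) * ennreal ((2 * R) ^ (n - 1) * norm z)"
      using le[of z] 1 by (intro mult_mono) (auto simp: n_def)
    also have "\<dots> = ennreal (lam / norm z powr (real n + s) * ((2 * R) ^ (n - 1) * norm z))"
      using lam R by (intro ennreal_mult[symmetric]) auto
    also have "lam / norm z powr (real n + s) * ((2 * R) ^ (n - 1) * norm z) = C * norm z powr (-(real n - 1 + s))"
    proof -
      have "norm z powr (real n + s) = norm z powr (real n - 1 + s) * norm z"
        using z powr_mult_base[of "norm z" "real n - 1 + s"] by (simp add: mult.commute)
      moreover have "norm z powr (-(real n - 1 + s)) = inverse (norm z powr (real n - 1 + s))"
        by (rule powr_minus)
      moreover have "norm z powr (real n - 1 + s) > 0" "norm z > 0" using z by simp_all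
      ultimately show ?thesis by (simp only: C_def) (simp add: field_simps)
    qed
    also have "ennreal (C * norm z powr (-(real n - 1 + s))) = ennreal C * ennreal (norm z powr (-(real n - 1 + s)))"
      using lam R by (intro ennreal_mult) (auto simp: C_def)
    finally show ?thesis using zR by (simp add: indicator_def)
  qed
  have "nonlocal_energy k ?E ?F = (\<integral>\<^sup>+x. (\<integral>\<^sup>+z. k z * indicator ?F (x - z) * indicator ?E x \<partial>lborel) \<partial>lborel)"
    unfolding nonlocal_energy_def
  proof (rule nn_integral_cong)
    fix x
    have "(\<integral>\<^sup>+y. k (x - y) * indicator ?F y \<partial>lborel) = (\<integral>\<^sup>+z. k z * indicator ?F (x - z) \<partial>lborel)"
      using nn_integral_reflection[of "\<lambda>z. k z * indicator ?F (x - z)" x] by simp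
    then show "(\<integral>\<^sup>+y. k (x - y) * indicator ?F y \<partial>lborel) * indicator ?E x =
        (\<integral>\<^sup>+z. k z * indicator ?F (x - z) * indicator ?E x \<partial>lborel)"
      by (simp add: nn_integral_multc)
  qed
  also have "\<dots> = (\<integral>\<^sup>+z. (\<integral>\<^sup>+x. k z * indicator ?F (x - z) * indicator ?E x \<partial>lborel) \<partial>lborel)"
    by (rule lborel_pair.Fubini') measurable
  also have "\<dots> = (\<integral>\<^sup>+z. k z * (\<integral>\<^sup>+x. indicator ?F (x - z) * indicator ?E x \<partial>lborel) \<partial>lborel)"
    by (simp add: mult.assoc nn_integral_cmult)
  also have "\<dots> \<le> (\<integral>\<^sup>+z. ennreal C * (ennreal (norm z powr (-(real n - 1 + s))) * indicator (cball 0 (2 * R)) (z::real^'n)) \<partial>lborel)"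
    by (intro nn_integral_mono slice)
  also have "\<dots> = ennreal C * (\<integral>\<^sup>+z. ennreal (norm z powr (-(real n - 1 + s))) * indicator (cball 0 (2 * R)) (z::real^'n) \<partial>lborel)"
    by (rule nn_integral_cmult, intro borel_measurable_times_ennreal borel_measurable_indicator) simp_all
  also have "\<dots> < \<infinity>"
    using nn_integral_norm_powr_finite[of "real n - 1 + s" "2 * R", where 'a = "real^'n"] n s R
    by (simp add: ennreal_mult_less_top n_def)
  finally show ?thesis .
qed

text \<open>The volume below level \<open>t\<close> is Lipschitz in \<open>t\<close>, by the slab estimate, and runs from \<open>0\<close> to the
  measure of \<open>\<Omega>\<close>; the intermediate value theorem applies.\<close>

lemma exists_halfspace_section_of_volume:
  fixes \<Omega> :: "(real^'n) set" and i :: 'n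
  assumes [measurable]: "\<Omega> \<in> sets borel" and "bounded \<Omega>" and m: "0 < m" "m < measure lborel \<Omega>"
  obtains t where "measure lborel {x \<in> \<Omega>. x $ i < t} = m"
proof -
  obtain R where R: "R > 0" "\<Omega> \<subseteq> cball 0 R"
    using \<open>bounded \<Omega>\<close> bounded_subset_ballD[of \<Omega> 0] ball_subset_cball by blast
  define \<phi> where "\<phi> t = measure lborel {x \<in> \<Omega>. x $ i < t}" for t
  define C where "C = (2 * R) ^ (CARD('n) - 1)"
  have ball: "cball (0::real^'n) R \<in> fmeasurable lborel"
    by (rule fmeasurableI) (simp, rule emeasure_lborel_cball_finite)
  have fin: "A \<in> fmeasurable lborel" if "A \<in> sets borel" "A \<subseteq> cball 0 R" for A :: "(real^'n) set"
    using fmeasurableI2[OF ball, of A] that by simp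
  have mono: "\<phi> b - \<phi> a \<le> C * (b - a)" "\<phi> a \<le> \<phi> b" if "a \<le> b" for a b
  proof -
    let ?S = "{x \<in> cball 0 R. a \<le> x $ i \<and> x $ i \<le> b}"
    have [measurable]: "?S \<in> sets borel" by measurable
    have "\<phi> b \<le> measure lborel ({x \<in> \<Omega>. x $ i < a} \<union> ?S)"
      unfolding \<phi>_def using R by (intro measure_mono_fmeasurable fin) auto
    also have "\<dots> \<le> \<phi> a + measure lborel ?S"
      unfolding \<phi>_def by (intro measure_Un_le) measurable
    also have "measure lborel ?S \<le> C * (b - a)"
    proof -
      have "emeasure lborel ?S \<le> ennreal (C * (b - a))"
        unfolding C_def using R that by (intro emeasure_slab_le) auto
      then show ?thesis
        using R that by (simp add: measure_def C_def enn2real_leI)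
    qed
    finally show "\<phi> b - \<phi> a \<le> C * (b - a)" by simp
    show "\<phi> a \<le> \<phi> b"
      unfolding \<phi>_def using R that by (intro measure_mono_fmeasurable fin) auto
  qed
  have "C-lipschitz_on UNIV \<phi>"
  proof (rule lipschitz_onI)
    show "dist (\<phi> x) (\<phi> y) \<le> C * dist x y" for x y
      using mono[of x y] mono[of y x] by (cases "x \<le> y") (auto simp: dist_real_def)
    show "0 \<le> C" using R by (simp add: C_def)
  qed
  then have cont: "continuous_on UNIV \<phi>" by (rule lipschitz_on_continuous_on)
  have comp: "- R \<le> x $ i \<and> x $ i \<le> R" if "x \<in> \<Omega>" for x
    using component_le_norm_cart[of x i] that R(2) by (force simp: subset_iff abs_le_iff)
  have "{x \<in> \<Omega>. x $ i < - R} = {}" "{x \<in> \<Omega>. x $ i < R + 1} = \<Omega>"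
    using comp by force+
  then have "\<phi> (-R) = 0" "\<phi> (R + 1) = measure lborel \<Omega>" unfolding \<phi>_def by (simp_all only: measure_empty)
  then have "\<phi> (-R) \<le> m" "m \<le> \<phi> (R + 1)" using m by auto
  then obtain t where "\<phi> t = m"
    using IVT'[of \<phi> "-R" m "R + 1"] R continuous_on_subset[OF cont] by auto
  then show ?thesis using that unfolding \<phi>_def by blast
qed

section \<open>Averages over dyadic cubes\<close>

text \<open>The index of the half-open dyadic cube of side \<open>1 / 2 ^ k\<close> that contains \<open>x\<close>.  Indexing the cubes by a
  countable type makes cubewise constant functions measurable for free and is what the diagonal
  argument runs over.\<close>

definition dyadic_cell :: "nat \<Rightarrow> real ^ 'n \<Rightarrow> int ^ 'n" where
  "dyadic_cell k x = (\<chi> i. \<lfloor>2 ^ k * x $ i\<rfloor>)"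

lemma dyadic_cell_eq_iff: "dyadic_cell k x = v \<longleftrightarrow> (\<forall>i. \<lfloor>2 ^ k * x $ i\<rfloor> = v $ i)"
  by (auto simp: dyadic_cell_def vec_eq_iff)

lemma sets_dyadic_cell: "{y. dyadic_cell k y = v} \<in> sets borel"
  unfolding dyadic_cell_eq_iff by measurable

lemma measurable_dyadic_cell [measurable]:
  "dyadic_cell k \<in> borel \<rightarrow>\<^sub>M count_space (UNIV :: (int^'n) set)"
proof (subst measurable_count_space_eq2_countable, safe)
  fix v :: "int^'n"
  have "dyadic_cell k -` {v} \<inter> space borel = {y. dyadic_cell k y = v}" by auto
  then show "dyadic_cell k -` {v} \<inter> space borel \<in> sets borel"
    using sets_dyadic_cell[of k v] by simp
qed simp_all

lemma measurable_dyadic_cell_eq [measurable]: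
  "Measurable.pred (borel \<Otimes>\<^sub>M borel) (\<lambda>(x, y). dyadic_cell k x = (dyadic_cell k y :: int^'n))"
  by measurable

lemma norm_diff_dyadic_cell:
  fixes x y :: "real^'n"
  assumes "dyadic_cell k x = dyadic_cell k y"
  shows "norm (x - y) \<le> real CARD('n) / 2 ^ k"
proof -
  have "\<bar>(x - y) $ i\<bar> \<le> 1 / 2 ^ k" for i
  proof -
    have "\<lfloor>2 ^ k * x $ i\<rfloor> = \<lfloor>2 ^ k * y $ i\<rfloor>"
      using assms by (simp add: dyadic_cell_def vec_eq_iff)
    then have "\<bar>2 ^ k * x $ i - 2 ^ k * y $ i\<bar> \<le> 1" by linarith
    then have "2 ^ k * \<bar>x $ i - y $ i\<bar> \<le> 1"
      by (simp add: right_diff_distrib[symmetric] abs_mult)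
    then show ?thesis by (simp add: field_simps)
  qed
  then have "(\<Sum>i\<in>UNIV. \<bar>(x - y) $ i\<bar>) \<le> (\<Sum>i\<in>(UNIV::'n set). 1 / 2 ^ k)"
    by (intro sum_mono)
  then show ?thesis using norm_le_l1_cart[of "x - y"] by simp
qed

lemma emeasure_dyadic_cell:
  "emeasure lborel {y::real^'n. dyadic_cell k y = v} = ennreal (1 / 2 ^ (k * CARD('n)))"
proof -
  define l u :: "real^'n" where "l = (\<chi> i. v $ i / 2 ^ k)" and "u = (\<chi> i. (v $ i + 1) / 2 ^ k)"
  let ?Q = "{y::real^'n. dyadic_cell k y = v}"
  have lu: "l $ i \<le> u $ i" for i by (simp add: l_def u_def divide_simps)
  have "cbox l u \<noteq> {}" using lu by (simp add: interval_ne_empty_cart)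
  then have "measure lborel (cbox l u) = (\<Prod>i\<in>(UNIV::'n set). 1 / 2 ^ k)"
    by (subst content_cbox_cart) (auto simp: l_def u_def diff_divide_distrib[symmetric])
  also have "\<dots> = 1 / 2 ^ (k * CARD('n))"
    by (simp add: power_divide power_mult)
  finally have c: "emeasure lborel (cbox l u) = ennreal (1 / 2 ^ (k * CARD('n)))"
    using emeasure_lborel_cbox_finite[of l u] by (simp add: emeasure_eq_ennreal_measure)
  have b: "emeasure lborel (box l u) = emeasure lborel (cbox l u)"
    by (simp add: emeasure_lborel_box_eq emeasure_lborel_cbox_eq)
  \<comment> \<open>The half-open cube lies between an open and a closed box of the same measure.\<close>
  have "box l u \<subseteq> ?Q"
  proof
    fix y assume y: "y \<in> box l u"
    have "\<lfloor>2 ^ k * y $ i\<rfloor> = v $ i" for i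
    proof -
      have "v $ i / 2 ^ k < y $ i" "y $ i < (v $ i + 1) / 2 ^ k"
        using y by (auto simp: mem_box_cart l_def u_def)
      then have "v $ i < 2 ^ k * y $ i" "2 ^ k * y $ i < v $ i + 1"
        by (simp_all add: field_simps)
      then show ?thesis by linarith
    qed
    then show "y \<in> ?Q" by (simp add: dyadic_cell_eq_iff)
  qed
  moreover have "?Q \<subseteq> cbox l u"
  proof
    fix y assume y: "y \<in> ?Q"
    have "l $ i \<le> y $ i \<and> y $ i \<le> u $ i" for i
    proof -
      have "\<lfloor>2 ^ k * y $ i\<rfloor> = v $ i" using y by (simp add: dyadic_cell_eq_iff)
      then have "v $ i \<le> 2 ^ k * y $ i" "2 ^ k * y $ i \<le> v $ i + 1" by linarith+
      then show ?thesis by (simp add: field_simps l_def u_def)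
    qed
    then show "y \<in> cbox l u" by (simp add: mem_box_cart)
  qed
  ultimately have "emeasure lborel (box l u) \<le> emeasure lborel ?Q"
    "emeasure lborel ?Q \<le> emeasure lborel (cbox l u)"
    using sets_dyadic_cell[of k v] by (auto intro!: emeasure_mono)
  then show ?thesis using b c by simp
qed

text \<open>The mean of the indicator of \<open>E\<close> over the dyadic cube of \<open>x\<close>; the leading factor is the inverse of
  the measure of the cube.\<close>

definition cell_average :: "nat \<Rightarrow> (real^'n) set \<Rightarrow> real^'n \<Rightarrow> real" where
  "cell_average k E x =
     2 ^ (k * CARD('n)) * measure lborel (E \<inter> {y. dyadic_cell k y = dyadic_cell k x})"

lemma measurable_cell_average [measurable]:
  fixes E :: "(real^'n) set"
  shows "cell_average k E \<in> borel_measurable borel"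
proof -
  have "(\<lambda>v. 2 ^ (k * CARD('n)) * measure lborel (E \<inter> {y::real^'n. dyadic_cell k y = v}))
      \<in> count_space (UNIV :: (int^'n) set) \<rightarrow>\<^sub>M borel" by simp
  from measurable_compose[OF measurable_dyadic_cell this]
  show ?thesis unfolding cell_average_def by simp
qed

lemma cell_average_complement:
  fixes E :: "(real^'n) set"
  assumes [measurable]: "E \<in> sets borel"
  shows "cell_average k E x + cell_average k (- E) x = 1"
proof -
  let ?Q = "{y::real^'n. dyadic_cell k y = dyadic_cell k x}"
  have Q: "?Q \<in> fmeasurable lborel"
    by (rule fmeasurableI) (simp_all add: sets_dyadic_cell emeasure_dyadic_cell)
  have m: "E \<inter> ?Q \<in> fmeasurable lborel" "- E \<inter> ?Q \<in> fmeasurable lborel"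
    using fmeasurable_Int_fmeasurable[OF Q, of E] fmeasurable_Int_fmeasurable[OF Q, of "- E"]
    by (simp_all add: Int_commute)
  have "measure lborel ?Q = measure lborel ((E \<inter> ?Q) \<union> (- E \<inter> ?Q))"
    by (rule arg_cong[where f = "measure lborel"]) auto
  also have "\<dots> = measure lborel (E \<inter> ?Q) + measure lborel (- E \<inter> ?Q)"
    using m by (intro measure_Union) (auto simp: fmeasurable_def)
  finally have "measure lborel (E \<inter> ?Q) + measure lborel (- E \<inter> ?Q) = 1 / 2 ^ (k * CARD('n))"
    by (simp add: measure_def emeasure_dyadic_cell)
  then show ?thesis
    unfolding cell_average_def by (simp add: distrib_left[symmetric])
qed

lemma cell_average_nonneg: "0 \<le> cell_average k E x"
  by (simp add: cell_average_def)

lemma cell_average_eq_nn_integral: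
  fixes E :: "(real^'n) set"
  assumes [measurable]: "E \<in> sets borel"
  shows "ennreal (cell_average k E x) =
    ennreal (2 ^ (k * CARD('n))) *
      (\<integral>\<^sup>+y. indicator E y * indicator {y. dyadic_cell k y = dyadic_cell k x} y \<partial>lborel)"
proof -
  let ?Q = "{y::real^'n. dyadic_cell k y = dyadic_cell k x}"
  have [measurable]: "?Q \<in> sets borel" by (rule sets_dyadic_cell)
  have "emeasure lborel (E \<inter> ?Q) \<le> emeasure lborel ?Q" by (intro emeasure_mono) auto
  then have "emeasure lborel (E \<inter> ?Q) \<noteq> \<infinity>"
    by (auto simp: emeasure_dyadic_cell top_unique)
  then have "ennreal (measure lborel (E \<inter> ?Q)) = emeasure lborel (E \<inter> ?Q)"
    by (simp add: emeasure_eq_ennreal_measure)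
  also have "\<dots> = (\<integral>\<^sup>+y. indicator (E \<inter> ?Q) y \<partial>lborel)" by simp
  also have "\<dots> = (\<integral>\<^sup>+y. indicator E y * indicator ?Q y \<partial>lborel)"
    by (simp add: indicator_inter_arith)
  finally show ?thesis
    unfolding cell_average_def by (simp add: ennreal_mult)
qed

text \<open>On \<open>E\<close> the deviation is the average of \<open>- E\<close>, and off \<open>E\<close> it is the average of \<open>E\<close>.  Both
  parts integrate to the same quantity by Tonelli: the normalised measure of the pairs in
  \<open>E \<times> (- E)\<close> that share a cube.  On those pairs the kernel dominates the normalising factor.\<close>

lemma cell_average_deviation:
  fixes E :: "(real^'n) set" and k :: "real^'n \<Rightarrow> ennreal"
  assumes [measurable]: "k \<in> borel_measurable borel" "E \<in> sets borel"
    and \<beta>: "\<And>x y. x \<noteq> y \<Longrightarrow> dyadic_cell j x = dyadic_cell j y \<Longrightarrow>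
        ennreal (2 ^ (j * CARD('n))) \<le> \<beta> * k (x - y)"
  shows "(\<integral>\<^sup>+x. ennreal \<bar>indicator E x - cell_average j E x\<bar> \<partial>lborel)
      \<le> 2 * (\<beta> * nonlocal_energy k E (- E))"
proof -
  define N where "N = ennreal (2 ^ (j * CARD('n)))"
  define S where "S = {p :: (real^'n) \<times> (real^'n). dyadic_cell j (fst p) = dyadic_cell j (snd p)}"
  have [measurable]: "S \<in> sets (borel \<Otimes>\<^sub>M borel)"
    using measurable_dyadic_cell_eq[of j] unfolding S_def pred_def by (simp add: space_pair_measure case_prod_beta)
  define P where "P = (\<integral>\<^sup>+x. \<integral>\<^sup>+y. N * indicator S (x, y) * indicator E x * indicator (- E) y \<partial>lborel \<partial>lborel)"
  have "ennreal \<bar>indicator E x - cell_average j E x\<bar> =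
      (\<integral>\<^sup>+y. N * indicator S (x, y) * indicator E x * indicator (- E) y \<partial>lborel) +
      (\<integral>\<^sup>+y. N * indicator S (y, x) * indicator E y * indicator (- E) x \<partial>lborel)" for x
  proof -
    have 1: "(\<integral>\<^sup>+y. N * indicator S (x, y) * indicator E x * indicator (- E) y \<partial>lborel) =
        indicator E x * ennreal (cell_average j (- E) x)"
      unfolding N_def cell_average_eq_nn_integral[OF borel_comp[OF assms(2)]]
      by (subst nn_integral_cmult[symmetric], simp add: sets_dyadic_cell,
          subst nn_integral_cmult[symmetric], simp add: sets_dyadic_cell)
        (auto intro!: nn_integral_cong simp: indicator_def S_def)
    have 2: "(\<integral>\<^sup>+y. N * indicator S (y, x) * indicator E y * indicator (- E) x \<partial>lborel) =
        indicator (- E) x * ennreal (cell_average j E x)"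
      unfolding N_def cell_average_eq_nn_integral[OF assms(2)]
      by (subst nn_integral_cmult[symmetric], simp add: sets_dyadic_cell,
          subst nn_integral_cmult[symmetric], simp add: sets_dyadic_cell)
        (auto intro!: nn_integral_cong simp: indicator_def S_def)
    show ?thesis
      unfolding 1 2 using cell_average_complement[OF assms(2), of j x] cell_average_nonneg[of j E x]
        cell_average_nonneg[of j "- E" x]
      by (cases "x \<in> E") (auto simp: algebra_simps)
  qed
  then have "(\<integral>\<^sup>+x. ennreal \<bar>indicator E x - cell_average j E x\<bar> \<partial>lborel) =
      P + (\<integral>\<^sup>+x. \<integral>\<^sup>+y. N * indicator S (y, x) * indicator E y * indicator (- E) x \<partial>lborel \<partial>lborel)"
    unfolding P_def by (simp add: nn_integral_add)
  also have "(\<integral>\<^sup>+x. \<integral>\<^sup>+y. N * indicator S (y, x) * indicator E y * indicator (- E) x \<partial>lborel \<partial>lborel) = P"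
    unfolding P_def by (rule lborel_pair.Fubini') measurable
  also have "P + P = 2 * P" by (simp add: mult_2)
  also have "P \<le> (\<integral>\<^sup>+x. \<integral>\<^sup>+y. \<beta> * (k (x - y) * indicator (- E) y * indicator E x) \<partial>lborel \<partial>lborel)"
    unfolding P_def
  proof (intro nn_integral_mono)
    fix x y :: "real^'n"
    show "N * indicator S (x, y) * indicator E x * indicator (- E) y
        \<le> \<beta> * (k (x - y) * indicator (- E) y * indicator E x)"
      using \<beta>[of x y] by (cases "x = y") (auto simp: N_def S_def indicator_def)
  qed
  also have "\<dots> = \<beta> * nonlocal_energy k E (- E)"
    unfolding nonlocal_energy_def by (simp add: nn_integral_cmult nn_integral_multc)
  finally show ?thesis by (simp add: mult_left_mono)
qed

text \<open>Points in a common cube of side \<open>1 / 2 ^ j\<close> are at distance at most \<open>n / 2 ^ j\<close>, so the kernel between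
  them is at least \<open>2 ^ (j * n)\<close> divided by a constant times \<open>2 powr (- s * j)\<close>.  The lower bound on
  the kernel is available once \<open>n / 2 ^ j < \<rho>\<close>, hence only for large \<open>j\<close>.\<close>

lemma kernel_bound_on_dyadic_cells:
  fixes k :: "real^'n \<Rightarrow> ennreal"
  assumes lower: "\<And>z. ereal (norm z) < \<rho> \<Longrightarrow> ennreal (1 / (lam * norm z powr (real CARD('n) + s))) \<le> k z"
    and "\<rho> > 0" "lam > 0" "s > 0"
  obtains \<beta> :: "nat \<Rightarrow> real" where "\<beta> \<longlonglongrightarrow> 0" "\<And>j. \<beta> j \<ge> 0"
    "eventually (\<lambda>j. \<forall>x y. x \<noteq> y \<longrightarrow> dyadic_cell j x = dyadic_cell j y \<longrightarrow>
        ennreal (2 ^ (j * CARD('n))) \<le> ennreal (\<beta> j) * k (x - y)) sequentially"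
proof
  let ?n = "CARD('n)"
  define \<beta> where "\<beta> j = lam * real ?n powr (real ?n + s) * (2 powr (-s)) ^ j" for j
  have "2 powr (-s) < 1" using \<open>s > 0\<close> by (simp add: powr_less_one)
  then have "(\<lambda>j. (2 powr (-s)) ^ j) \<longlonglongrightarrow> 0" by (intro LIMSEQ_realpow_zero) auto
  from tendsto_mult_left[OF this, of "lam * real ?n powr (real ?n + s)"]
  show "\<beta> \<longlonglongrightarrow> 0" unfolding \<beta>_def by simp
  show "\<beta> j \<ge> 0" for j using \<open>lam > 0\<close> by (simp add: \<beta>_def)
  obtain r where r: "r > 0" "ereal r < \<rho>"
    using \<open>\<rho> > 0\<close> ereal_dense2[of 0 \<rho>] by auto
  have "(\<lambda>j. real ?n * (1 / 2) ^ j) \<longlonglongrightarrow> real ?n * 0"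
    by (intro tendsto_mult_left LIMSEQ_realpow_zero) auto
  then have "eventually (\<lambda>j. real ?n * (1 / 2) ^ j < r) sequentially"
    using r by (intro order_tendstoD) auto
  then show "eventually (\<lambda>j. \<forall>x y. x \<noteq> y \<longrightarrow> dyadic_cell j x = dyadic_cell j y \<longrightarrow>
        ennreal (2 ^ (j * CARD('n))) \<le> ennreal (\<beta> j) * k (x - y)) sequentially"
  proof eventually_elim
    case (elim j)
    show ?case
    proof (intro allI impI)
      fix x y :: "real^'n" assume xy: "x \<noteq> y" "dyadic_cell j x = dyadic_cell j y"
      define d where "d = real ?n * (1 / 2) ^ j"
      have d: "norm (x - y) \<le> d" using norm_diff_dyadic_cell[OF xy(2)] by (simp add: d_def power_divide)
      have pos: "0 < norm (x - y)" using xy by simp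
      have "norm (x - y) < r" using d elim by (simp add: d_def)
      then have "ereal (norm (x - y)) < \<rho>" using r(2) by (meson ereal_less(2) less_ereal.simps(1) order.strict_trans)
      note low = lower[OF this]
      have "norm (x - y) powr (real ?n + s) \<le> d powr (real ?n + s)"
        using d \<open>s > 0\<close> by (intro powr_mono2) auto
      also have "d powr (real ?n + s) = real ?n powr (real ?n + s) * ((1 / 2) ^ j) powr (real ?n + s)"
        unfolding d_def by (subst powr_mult) auto
      also have "((1 / (2::real)) ^ j) powr (real ?n + s) = (2 powr (-s)) ^ j / 2 ^ (j * ?n)"
      proof -
        have "(1 / (2::real)) ^ j = 2 powr (- real j)"
          by (simp add: powr_minus powr_realpow power_divide divide_simps)
        then have "((1 / (2::real)) ^ j) powr (real ?n + s) = 2 powr (- real j * (real ?n + s))"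
          by (simp add: powr_powr)
        also have "\<dots> = 2 powr (-s * real j) / 2 powr (real (j * ?n))"
          by (simp add: powr_diff[symmetric] algebra_simps)
        also have "2 powr (-s * real j) = (2 powr (-s)) ^ j"
          by (subst powr_powr[symmetric]) (simp add: powr_realpow)
        finally show ?thesis by (simp add: powr_realpow del: of_nat_mult)
      qed
      finally have "norm (x - y) powr (real ?n + s)
          \<le> real ?n powr (real ?n + s) * ((2 powr (-s)) ^ j / 2 ^ (j * ?n))" .
      from mult_left_mono[OF this, of lam]
      have "lam * norm (x - y) powr (real ?n + s) \<le> \<beta> j / 2 ^ (j * ?n)"
        using \<open>lam > 0\<close> by (simp add: \<beta>_def mult.assoc)
      then have "2 ^ (j * ?n) \<le> \<beta> j * (1 / (lam * norm (x - y) powr (real ?n + s)))"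
        using pos \<open>lam > 0\<close> by (simp add: field_simps)
      then have "ennreal (2 ^ (j * ?n)) \<le> ennreal (\<beta> j * (1 / (lam * norm (x - y) powr (real ?n + s))))"
        by (rule ennreal_leI)
      also have "\<dots> = ennreal (\<beta> j) * ennreal (1 / (lam * norm (x - y) powr (real ?n + s)))"
        using \<open>lam > 0\<close> by (intro ennreal_mult) (auto simp: \<beta>_def)
      also have "\<dots> \<le> ennreal (\<beta> j) * k (x - y)"
        using low by (intro mult_left_mono) auto
      finally show "ennreal (2 ^ (j * ?n)) \<le> ennreal (\<beta> j) * k (x - y)" .
    qed
  qed
qed

section \<open>Compactness of sets of bounded nonlocal perimeter\<close>

text \<open>Bolzano--Weierstrass in each coordinate, combined by Cantor's diagonal argument.\<close>

lemma diagonal_convergent_subsequence: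
  fixes f :: "nat \<Rightarrow> 'i::countable \<Rightarrow> real"
  assumes "\<And>i. bounded (range (\<lambda>j. f j i))"
  obtains r :: "nat \<Rightarrow> nat" where "strict_mono r" "\<And>i. convergent (\<lambda>j. f (r j) i)"
proof -
  define P where "P n s \<longleftrightarrow> convergent (\<lambda>j. f (s j) (from_nat n))" for n and s :: "nat \<Rightarrow> nat"
  interpret subseqs P
  proof
    fix n and s :: "nat \<Rightarrow> nat"
    have "bounded (range (\<lambda>j. f (s j) (from_nat n)))"
      by (rule bounded_subset[OF assms[of "from_nat n"]]) auto
    from bounded_imp_convergent_subsequence[OF this]
    show "\<exists>r'. strict_mono r' \<and> P n (s \<circ> r')"
      by (auto simp: P_def convergent_def o_def)
  qed
  have "convergent (\<lambda>j. f (diagseq j) i)" for i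
  proof -
    have "P (to_nat i) (diagseq \<circ> ((+) (Suc (to_nat i))))"
    proof (rule diagseq_holds)
      fix r s :: "nat \<Rightarrow> nat" and n assume "strict_mono r" "P n s"
      then show "P n (s \<circ> r)"
        using convergent_subseq_convergent[of "\<lambda>j. f (s j) (from_nat n)" r]
        by (simp add: P_def o_def)
    qed
    then obtain l where "(\<lambda>j. f (diagseq (j + Suc (to_nat i))) i) \<longlonglongrightarrow> l"
      by (auto simp: P_def convergent_def o_def add.commute)
    then have "(\<lambda>j. f (diagseq j) i) \<longlonglongrightarrow> l" by (rule LIMSEQ_offset)
    then show ?thesis by (auto simp: convergent_def)
  qed
  with subseq_diagseq that show ?thesis by blast
qed

text \<open>A Cauchy sequence of zeros and ones is eventually constant, so the set-theoretic lower limit is a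
  pointwise limit.\<close>

lemma Cauchy_indicator_imp_eventually_stable:
  assumes "Cauchy (\<lambda>j. indicator (A j) x :: real)"
  shows "\<forall>\<^sub>F j in sequentially. x \<in> A j \<longleftrightarrow> x \<in> {x. \<exists>N. \<forall>j\<ge>N. x \<in> A j}"
proof -
  obtain N where N: "\<And>i j. i \<ge> N \<Longrightarrow> j \<ge> N \<Longrightarrow> dist (indicator (A i) x :: real) (indicator (A j) x) < 1"
    using assms unfolding Cauchy_def by (meson zero_less_one)
  have eq: "x \<in> A j \<longleftrightarrow> x \<in> A N" if "j \<ge> N" for j
    using N[OF that order_refl] by (auto simp: indicator_def dist_real_def split: if_splits)
  have "(\<exists>M. \<forall>j\<ge>M. x \<in> A j) \<longleftrightarrow> x \<in> A N" using eq by (metis nat_le_linear)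
  then show ?thesis using eq unfolding eventually_sequentially by blast
qed

text \<open>A form of the compact embedding of fractional Sobolev spaces into \<open>L\<^sup>1\<close>.  The indicators are within
  a uniformly small \<open>L\<^sup>1\<close> distance of their averages over small cubes, and the averages converge
  along a diagonal subsequence.\<close>

lemma finite_nonlocal_energy_compactness:
  fixes E :: "nat \<Rightarrow> (real^'n) set" and k :: "real^'n \<Rightarrow> ennreal"
  assumes k [measurable]: "k \<in> borel_measurable borel"
    and lower: "\<And>z. ereal (norm z) < \<rho> \<Longrightarrow> ennreal (1 / (lam * norm z powr (real CARD('n) + s))) \<le> k z"
    and pos: "\<rho> > 0" "lam > 0" "s > 0"
    and E [measurable]: "\<And>j. E j \<in> sets borel" and "bounded \<Omega>" and sub: "\<And>j. E j \<subseteq> \<Omega>"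
    and bd: "\<And>j. nonlocal_energy k (E j) (- E j) \<le> ennreal C"
  obtains r F where "strict_mono (r :: nat \<Rightarrow> nat)" "F \<in> sets borel" "F \<subseteq> \<Omega>"
    "AE x in lborel. \<forall>\<^sub>F j in sequentially. x \<in> E (r j) \<longleftrightarrow> x \<in> F"
proof -
  let ?n = "CARD('n)"
  obtain R where R: "R > 0" "\<Omega> \<subseteq> cball 0 R"
    using \<open>bounded \<Omega>\<close> bounded_subset_ballD[of \<Omega> 0] ball_subset_cball by blast
  \<comment> \<open>A cube that meets \<open>\<Omega>\<close> lies within distance \<open>n\<close> of it, whatever its generation.  So the
    indicator of \<open>B\<close> dominates all the averages at once.\<close>
  define B where "B = cball (0::real^'n) (R + real ?n)"
  have [measurable]: "B \<in> sets borel" by (simp add: B_def)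
  have B: "integrable lborel (indicator B :: _ \<Rightarrow> real)"
    unfolding B_def using emeasure_lborel_cball_finite by (auto simp: integrable_indicator_iff)
  have in_B: "x \<in> B" if "y \<in> \<Omega>" "dyadic_cell l y = dyadic_cell l x" for x y l
  proof -
    have "norm (y - x) \<le> real ?n / 2 ^ l" using norm_diff_dyadic_cell[OF that(2)] .
    also have "\<dots> \<le> real ?n" by (simp add: divide_simps mult_le_cancel_left1)
    finally have "norm x \<le> norm y + real ?n" using norm_triangle_ineq3[of x y] by (simp add: norm_minus_commute)
    then show ?thesis using that R by (auto simp: B_def subset_iff)
  qed
  have avg_le: "cell_average l (E j) x \<le> indicator B x" for l j x
  proof (cases "x \<in> B")
    case True
    then show ?thesis
      using cell_average_complement[OF E[of j], of l x] cell_average_nonneg[of l "- E j" x] by simp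
  next
    case False
    then have "E j \<inter> {y. dyadic_cell l y = dyadic_cell l x} = {}" using in_B sub by blast
    then show ?thesis by (simp add: cell_average_def)
  qed
  have avg_abs: "\<bar>cell_average l (E j) x\<bar> \<le> indicator B x" for l j x
    using avg_le[of l j x] cell_average_nonneg[of l "E j" x] by simp
  have int_avg: "integrable lborel (cell_average l (E j))" for l j
    by (rule Bochner_Integration.integrable_bound[OF B])
      (auto intro!: AE_I2 simp: avg_abs)
  have E_B: "E j \<subseteq> B" for j using in_B[OF _ refl] sub by blast
  have int_E: "integrable lborel (indicator (E j) :: _ \<Rightarrow> real)" for j
    by (rule Bochner_Integration.integrable_bound[OF B])
      (use E_B in \<open>auto intro!: AE_I2 simp: indicator_def subset_iff\<close>)

  \<comment> \<open>Extraction of a subsequence along which the mass in every dyadic cube converges.\<close>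
  have "\<bar>measure lborel (E j \<inter> {y. dyadic_cell (fst i) y = snd i})\<bar> \<le> measure lborel B" for j and i :: "nat \<times> (int^'n)"
  proof -
    have "E j \<inter> {y. dyadic_cell (fst i) y = snd i} \<subseteq> B" using E_B by blast
    moreover have "B \<in> fmeasurable lborel"
      unfolding B_def by (rule fmeasurableI) (simp, rule emeasure_lborel_cball_finite)
    ultimately show ?thesis
      using sets_dyadic_cell[of "fst i" "snd i"] E[of j]
      by (subst abs_of_nonneg) (auto intro!: measure_mono_fmeasurable)
  qed
  then have "bounded (range (\<lambda>j. measure lborel (E j \<inter> {y. dyadic_cell (fst i) y = snd i})))" for i :: "nat \<times> (int^'n)"
    by (intro boundedI[of _ "measure lborel B"]) auto
  from diagonal_convergent_subsequence[of "\<lambda>j i. measure lborel (E j \<inter> {y. dyadic_cell (fst i) y = snd i})", OF this]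
  obtain d where d: "strict_mono d" and
    conv: "\<And>i. convergent (\<lambda>j. measure lborel (E (d j) \<inter> {y. dyadic_cell (fst i) y = snd i}))"
    by blast
  \<comment> \<open>For a fixed generation \<open>l\<close> of cubes the averages then converge pointwise, hence in \<open>L\<^sup>1\<close>.\<close>
  define A where "A l x = lim (\<lambda>j. cell_average l (E (d j)) x)" for l x
  have lim_A: "(\<lambda>j. cell_average l (E (d j)) x) \<longlonglongrightarrow> A l x" for l x
    unfolding A_def convergent_LIMSEQ_iff[symmetric] cell_average_def
    by (intro convergent_mult convergent_const) (use conv[of "(l, dyadic_cell l x)"] in simp)
  have [measurable]: "A l \<in> borel_measurable borel" for l
    by (rule borel_measurable_LIMSEQ_real[OF lim_A]) measurable
  have int_A: "integrable lborel (A l)" for l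
    by (rule integrable_dominated_convergence[where w = "indicator B" and s = "\<lambda>j. cell_average l (E (d j))"])
      (use B lim_A in \<open>auto simp: avg_abs\<close>)
  have L1_A: "(\<lambda>j. LINT x|lborel. \<bar>cell_average l (E (d j)) x - A l x\<bar>) \<longlonglongrightarrow> 0" for l
  proof -
    have A_bd: "0 \<le> A l x" "A l x \<le> indicator B x" for x
      using lim_A[of l x] avg_le[of l _ x] cell_average_nonneg[of l _ x]
      by (auto intro: LIMSEQ_le_const LIMSEQ_le_const2)
    have "(\<lambda>j. LINT x|lborel. \<bar>cell_average l (E (d j)) x - A l x\<bar>) \<longlonglongrightarrow> (LINT (x::real^'n)|lborel. (0::real))"
    proof (rule integral_dominated_convergence[where w = "indicator B"])
      show "AE x in lborel. (\<lambda>j. \<bar>cell_average l (E (d j)) x - A l x\<bar>) \<longlonglongrightarrow> 0"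
        using lim_A[of l] by (intro AE_I2 tendsto_rabs_zero) (simp add: LIM_zero_iff)
      show "AE x in lborel. norm \<bar>cell_average l (E (d j)) x - A l x\<bar> \<le> indicator B x" for j
      proof (rule AE_I2)
        fix x show "norm \<bar>cell_average l (E (d j)) x - A l x\<bar> \<le> indicator B x"
          using A_bd[of x] avg_le[of l "d j" x] cell_average_nonneg[of l "E (d j)" x] by (simp add: abs_le_iff)
      qed
    qed (use B in measurable)
    then show ?thesis by simp
  qed

  \<comment> \<open>The distance in \<open>L\<^sup>1\<close> between a set of the sequence and its averages is small uniformly in the set.\<close>
  from kernel_bound_on_dyadic_cells[OF lower pos]
  obtain \<beta> :: "nat \<Rightarrow> real" where \<beta>: "\<beta> \<longlonglongrightarrow> 0" "\<And>l. \<beta> l \<ge> 0" and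
    cells: "eventually (\<lambda>l. \<forall>x y. x \<noteq> y \<longrightarrow> dyadic_cell l x = dyadic_cell l y \<longrightarrow>
        ennreal (2 ^ (l * ?n)) \<le> ennreal (\<beta> l) * k (x - y)) sequentially" by blast
  define D where "D = max C 0"
  have dev: "eventually (\<lambda>l. \<forall>j. (LINT x|lborel. \<bar>indicator (E j) x - cell_average l (E j) x\<bar>) \<le> 2 * (\<beta> l * D)) sequentially"
    using cells
  proof eventually_elim
    case (elim l)
    show ?case
    proof
      fix j
      have "ennreal (LINT x|lborel. \<bar>indicator (E j) x - cell_average l (E j) x\<bar>) =
          (\<integral>\<^sup>+x. ennreal \<bar>indicator (E j) x - cell_average l (E j) x\<bar> \<partial>lborel)"
        by (rule nn_integral_eq_integral[symmetric]) (auto intro!: integrable_abs Bochner_Integration.integrable_diff int_E int_avg)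
      also have "\<dots> \<le> 2 * (ennreal (\<beta> l) * nonlocal_energy k (E j) (- E j))"
        using elim by (intro cell_average_deviation) auto
      also have "\<dots> \<le> 2 * (ennreal (\<beta> l) * ennreal D)"
        using order_trans[OF bd[of j] ennreal_leI[of C D]] by (intro mult_left_mono) (auto simp: D_def)
      also have "\<dots> = ennreal (2 * (\<beta> l * D))"
        using \<beta>(2)[of l] by (simp add: ennreal_mult D_def)
      finally show "(LINT x|lborel. \<bar>indicator (E j) x - cell_average l (E j) x\<bar>) \<le> 2 * (\<beta> l * D)"
        using \<beta>(2)[of l] by (subst (asm) ennreal_le_iff) (auto simp: D_def)
    qed
  qed
  \<comment> \<open>Comparing two sets through their averages and the limit \<open>A l\<close> splits their distance into four
    terms; the generation \<open>l\<close> is chosen first, then the index \<open>N\<close>.\<close>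
  have cauchy: "\<exists>N. \<forall>i\<ge>N. \<forall>j\<ge>N. (LINT x|lborel. norm (indicator (E (d i)) x - indicator (E (d j)) x :: real)) < e"
    if "e > 0" for e
  proof -
    have "(\<lambda>l. 2 * (\<beta> l * D)) \<longlonglongrightarrow> 2 * (0 * D)" using \<beta>(1) by (intro tendsto_intros)
    from order_tendstoD(2)[OF this, of "e / 4"]
    have "eventually (\<lambda>l. 2 * (\<beta> l * D) < e / 4) sequentially"
      using that by simp
    with dev have "eventually (\<lambda>l. \<forall>j. (LINT x|lborel. \<bar>indicator (E j) x - cell_average l (E j) x\<bar>) < e / 4) sequentially"
      by eventually_elim (blast intro: le_less_trans)
    then obtain l where l: "\<And>j. (LINT x|lborel. \<bar>indicator (E j) x - cell_average l (E j) x\<bar>) < e / 4"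
      by (auto simp: eventually_sequentially)
    have "eventually (\<lambda>j. (LINT x|lborel. \<bar>cell_average l (E (d j)) x - A l x\<bar>) < e / 4) sequentially"
      using order_tendstoD(2)[OF L1_A[of l], of "e / 4"] that by simp
    then obtain N where N: "\<And>j. j \<ge> N \<Longrightarrow> (LINT x|lborel. \<bar>cell_average l (E (d j)) x - A l x\<bar>) < e / 4"
      by (auto simp: eventually_sequentially)
    show ?thesis
    proof (intro exI[of _ N] allI impI)
      fix i j assume ij: "i \<ge> N" "j \<ge> N"
      let ?u = "\<lambda>j x. \<bar>indicator (E (d j)) x - cell_average l (E (d j)) x\<bar>"
      let ?v = "\<lambda>j x. \<bar>cell_average l (E (d j)) x - A l x\<bar>"
      have uv: "integrable lborel (?u j)" "integrable lborel (?v j)" for j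
        by (auto intro!: integrable_abs Bochner_Integration.integrable_diff int_E int_avg int_A)
      have "(LINT x|lborel. norm (indicator (E (d i)) x - indicator (E (d j)) x :: real))
          \<le> (LINT x|lborel. (?u i x + ?v i x) + (?u j x + ?v j x))"
      proof (rule integral_mono)
        show "integrable lborel (\<lambda>x. norm (indicator (E (d i)) x - indicator (E (d j)) x :: real))"
          by (intro integrable_norm Bochner_Integration.integrable_diff int_E)
        show "integrable lborel (\<lambda>x. (?u i x + ?v i x) + (?u j x + ?v j x))"
          by (intro Bochner_Integration.integrable_add uv)
        show "norm (indicator (E (d i)) x - indicator (E (d j)) x :: real) \<le> (?u i x + ?v i x) + (?u j x + ?v j x)" for x
          unfolding real_norm_def by linarith
      qed
      also have "\<dots> = (LINT x|lborel. ?u i x) + (LINT x|lborel. ?v i x) + ((LINT x|lborel. ?u j x) + (LINT x|lborel. ?v j x))"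
        by (simp add: uv)
      also have "\<dots> < e" using l[of "d i"] l[of "d j"] N[OF ij(1)] N[OF ij(2)] by linarith
      finally show "(LINT x|lborel. norm (indicator (E (d i)) x - indicator (E (d j)) x :: real)) < e" .
    qed
  qed
  obtain r where r: "strict_mono r" "AE x in lborel. Cauchy (\<lambda>i. indicator (E (d (r i))) x :: real)"
    using cauchy_L1_AE_cauchy_subseq[of lborel "\<lambda>j. indicator (E (d j)) :: _ \<Rightarrow> real", OF int_E cauchy] by blast
  \<comment> \<open>The lower limit of the sets is contained in \<open>\<Omega>\<close> everywhere, not just up to a null set.\<close>
  define F where "F = {x. \<exists>N. \<forall>j\<ge>N. x \<in> E (d (r j))}"
  show ?thesis
  proof
    show "strict_mono (d \<circ> r)" using d r(1) by (rule strict_mono_o)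
    have "F = {x \<in> space borel. \<exists>N. \<forall>j\<in>{N..}. x \<in> E (d (r j))}" by (auto simp: F_def)
    also have "\<dots> \<in> sets borel" by measurable
    finally show "F \<in> sets borel" .
    show "F \<subseteq> \<Omega>" using sub by (auto simp: F_def)
    show "AE x in lborel. \<forall>\<^sub>F j in sequentially. x \<in> E ((d \<circ> r) j) \<longleftrightarrow> x \<in> F"
      using r(2) unfolding F_def o_def
      by eventually_elim (rule Cauchy_indicator_imp_eventually_stable)
  qed
qed

section \<open>Semicontinuity and continuity under almost everywhere convergence\<close>

lemma tendsto_indicator_of_eventually:
  assumes "\<forall>\<^sub>F j in sequentially. x \<in> A j \<longleftrightarrow> x \<in> B"
  shows "(\<lambda>j. c * indicator (A j) x) \<longlonglongrightarrow> (c * indicator B x :: 'a::{topological_space, semiring_1})"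
  by (rule tendsto_eventually) (use assms in eventually_elim, auto simp: indicator_def)

text \<open>Fatou's lemma, once in each variable.\<close>

lemma nonlocal_energy_lower_semicontinuous:
  assumes [measurable]: "k \<in> borel_measurable borel" "\<And>j. A j \<in> sets borel" "\<And>j. B j \<in> sets borel"
    and A: "AE x in lborel. \<forall>\<^sub>F j in sequentially. x \<in> A j \<longleftrightarrow> x \<in> A'"
    and B: "AE x in lborel. \<forall>\<^sub>F j in sequentially. x \<in> B j \<longleftrightarrow> x \<in> B'"
  shows "nonlocal_energy k A' B' \<le> liminf (\<lambda>j. nonlocal_energy k (A j) (B j))"
proof -
  define w where "w j x = (\<integral>\<^sup>+y. k (x - y) * indicator (B j) y \<partial>lborel)" for j x
  have [measurable]: "w j \<in> borel_measurable borel" for j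
    unfolding w_def by measurable
  have inner: "(\<integral>\<^sup>+y. k (x - y) * indicator B' y \<partial>lborel) \<le> liminf (\<lambda>j. w j x)" for x
  proof -
    have "(\<integral>\<^sup>+y. k (x - y) * indicator B' y \<partial>lborel)
        \<le> (\<integral>\<^sup>+y. liminf (\<lambda>j. k (x - y) * indicator (B j) y) \<partial>lborel)"
      by (rule nn_integral_mono_AE, use B in eventually_elim)
        (auto intro!: Liminf_bounded elim!: eventually_mono simp: indicator_def)
    also have "\<dots> \<le> liminf (\<lambda>j. w j x)"
      unfolding w_def by (rule nn_integral_liminf) measurable
    finally show ?thesis .
  qed
  have "nonlocal_energy k A' B' \<le> (\<integral>\<^sup>+x. liminf (\<lambda>j. w j x * indicator (A j) x) \<partial>lborel)"
    unfolding nonlocal_energy_def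
  proof (rule nn_integral_mono_AE, use A in eventually_elim)
    fix x assume ev: "\<forall>\<^sub>F j in sequentially. x \<in> A j \<longleftrightarrow> x \<in> A'"
    show "(\<integral>\<^sup>+y. k (x - y) * indicator B' y \<partial>lborel) * indicator A' x \<le> liminf (\<lambda>j. w j x * indicator (A j) x)"
    proof (cases "x \<in> A'")
      case True
      then have "\<forall>\<^sub>F j in sequentially. w j x * indicator (A j) x = w j x"
        using ev by (auto elim!: eventually_mono)
      from Liminf_eq[OF this] show ?thesis using inner[of x] True by simp
    qed simp
  qed
  also have "\<dots> \<le> liminf (\<lambda>j. nonlocal_energy k (A j) (B j))"
    unfolding nonlocal_energy_def w_def[symmetric] by (rule nn_integral_liminf) measurable
  finally show ?thesis .
qed

lemma nonlocal_energy_mono: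
  assumes "A \<subseteq> A'" "B \<subseteq> B'"
  shows "nonlocal_energy k A B \<le> nonlocal_energy k A' B'"
  unfolding nonlocal_energy_def using assms
  by (intro nn_integral_mono mult_mono) (auto simp: indicator_def)

lemma nonlocal_energy_Un_right:
  assumes [measurable]: "k \<in> borel_measurable borel" "A \<in> sets borel" "B \<in> sets borel" "C \<in> sets borel"
    and "B \<inter> C = {}"
  shows "nonlocal_energy k A (B \<union> C) = nonlocal_energy k A B + nonlocal_energy k A C"
proof -
  have "indicator (B \<union> C) y = indicator B y + (indicator C y :: ennreal)" for y
    using \<open>B \<inter> C = {}\<close> by (auto simp: indicator_def)
  then show ?thesis
    unfolding nonlocal_energy_def by (simp add: distrib_left distrib_right nn_integral_add)
qed

text \<open>The energy against a fixed set \<open>B\<close> is the integral over \<open>A\<close> of a fixed density, and finiteness for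
  \<open>\<Omega>\<close> makes this density a dominating function.\<close>

lemma nonlocal_energy_tendsto:
  assumes [measurable]: "k \<in> borel_measurable borel" "\<And>j. A j \<in> sets borel" "A' \<in> sets borel"
      "B \<in> sets borel" "\<Omega> \<in> sets borel"
    and A: "AE x in lborel. \<forall>\<^sub>F j in sequentially. x \<in> A j \<longleftrightarrow> x \<in> A'"
    and sub: "\<And>j. A j \<subseteq> \<Omega>" and fin: "nonlocal_energy k \<Omega> B < \<infinity>"
  shows "(\<lambda>j. nonlocal_energy k (A j) B) \<longlonglongrightarrow> nonlocal_energy k A' B"
  unfolding nonlocal_energy_def
proof (rule nn_integral_dominated_convergence)
  show "(\<integral>\<^sup>+x. (\<integral>\<^sup>+y. k (x - y) * indicator B y \<partial>lborel) * indicator \<Omega> x \<partial>lborel) < \<infinity>"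
    using fin by (simp add: nonlocal_energy_def)
  show "AE x in lborel. (\<lambda>j. (\<integral>\<^sup>+y. k (x - y) * indicator B y \<partial>lborel) * indicator (A j) x)
      \<longlonglongrightarrow> (\<integral>\<^sup>+y. k (x - y) * indicator B y \<partial>lborel) * indicator A' x"
    using A by eventually_elim (rule tendsto_indicator_of_eventually)
qed (use sub in \<open>auto intro!: AE_I2 mult_left_mono simp: indicator_def\<close>)

lemma emeasure_tendsto_of_eventually:
  assumes [measurable]: "\<And>j. A j \<in> sets M" "A' \<in> sets M" "\<Omega> \<in> sets M"
    and A: "AE x in M. \<forall>\<^sub>F j in sequentially. x \<in> A j \<longleftrightarrow> x \<in> A'"
    and sub: "\<And>j. A j \<subseteq> \<Omega>" and fin: "emeasure M \<Omega> < \<infinity>"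
  shows "(\<lambda>j. emeasure M (A j)) \<longlonglongrightarrow> emeasure M A'"
proof -
  have "(\<lambda>j. \<integral>\<^sup>+x. indicator (A j) x \<partial>M) \<longlonglongrightarrow> (\<integral>\<^sup>+x. indicator A' x \<partial>M)"
  proof (rule nn_integral_dominated_convergence[where w = "indicator \<Omega>"])
    show "AE x in M. (\<lambda>j. indicator (A j) x :: ennreal) \<longlonglongrightarrow> indicator A' x"
      using A by eventually_elim (use tendsto_indicator_of_eventually[where c = "1::ennreal"] in simp)
    show "AE x in M. indicator (A j) x \<le> (indicator \<Omega> x :: ennreal)" for j
      using sub by (auto simp: indicator_def)
  qed (use fin in auto)
  then show ?thesis by simp
qed

lemma set_integral_tendsto_of_eventually:
  fixes g :: "'a \<Rightarrow> real"
  assumes [measurable]: "\<And>j. A j \<in> sets M" "A' \<in> sets M"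
    and g: "set_integrable M \<Omega> g"
    and A: "AE x in M. \<forall>\<^sub>F j in sequentially. x \<in> A j \<longleftrightarrow> x \<in> A'"
    and sub: "\<And>j. A j \<subseteq> \<Omega>" "A' \<subseteq> \<Omega>"
  shows "(\<lambda>j. LINT x:A j|M. g x) \<longlonglongrightarrow> (LINT x:A'|M. g x)"
proof -
  define G where "G x = indicator \<Omega> x *\<^sub>R g x" for x
  have G: "integrable M G" using g unfolding set_integrable_def G_def .
  have [measurable]: "G \<in> borel_measurable M" using G by simp
  have eq: "(LINT x:B|M. g x) = (LINT x|M. G x * indicator B x)" if "B \<subseteq> \<Omega>" for B
    unfolding set_lebesgue_integral_def
    by (rule Bochner_Integration.integral_cong) (use that in \<open>auto simp: G_def indicator_def\<close>)
  have "(\<lambda>j. LINT x|M. G x * indicator (A j) x) \<longlonglongrightarrow> (LINT x|M. G x * indicator A' x)"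
  proof (rule integral_dominated_convergence[where w = "\<lambda>x. norm (G x)"])
    show "AE x in M. (\<lambda>j. G x * indicator (A j) x) \<longlonglongrightarrow> G x * indicator A' x"
      using A by eventually_elim (rule tendsto_indicator_of_eventually)
    show "AE x in M. norm (G x * indicator (A j) x) \<le> norm (G x)" for j
      by (auto simp: indicator_def)
  qed (use G in auto)
  then show ?thesis using eq sub by simp
qed

lemma abs_set_integral_le:
  fixes g :: "'a \<Rightarrow> real"
  assumes [measurable]: "A \<in> sets M" and g: "set_integrable M \<Omega> g" and sub: "A \<subseteq> \<Omega>"
  shows "\<bar>LINT x:A|M. g x\<bar> \<le> (LINT x:\<Omega>|M. \<bar>g x\<bar>)"
proof -
  have gA: "set_integrable M A g" using set_integrable_subset[OF g] sub by simp
  have "\<bar>LINT x:A|M. g x\<bar> \<le> (LINT x|M. norm (indicator A x *\<^sub>R g x))"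
    unfolding set_lebesgue_integral_def using integral_norm_bound[of M "\<lambda>x. indicator A x *\<^sub>R g x"] by simp
  also have "\<dots> \<le> (LINT x|M. norm (indicator \<Omega> x *\<^sub>R g x))"
    using g gA sub unfolding set_integrable_def
    by (intro integral_mono integrable_norm) (auto simp: indicator_def)
  also have "\<dots> = (LINT x:\<Omega>|M. \<bar>g x\<bar>)"
    unfolding set_lebesgue_integral_def by (rule Bochner_Integration.integral_cong) (auto simp: abs_mult)
  finally show ?thesis .
qed

section \<open>The direct method\<close>

text \<open>The splitting into a part \<open>I\<close> that may be infinite and is only lower semicontinuous and a real part
  \<open>L\<close> that is continuous avoids subtraction of extended reals.  Compactness is required only for
  sequences with bounded \<open>I\<close>; a minimizing sequence is of this kind because \<open>L\<close> is bounded below.\<close>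

lemma direct_method:
  fixes I :: "'a \<Rightarrow> ennreal" and L :: "'a \<Rightarrow> real"
  assumes E0: "E0 \<in> \<A>" "I E0 < \<infinity>" and low: "\<And>E. E \<in> \<A> \<Longrightarrow> - B \<le> L E"
    and compact: "\<And>E C. (\<And>j. E j \<in> \<A>) \<Longrightarrow> (\<And>j. I (E j) \<le> ennreal C) \<Longrightarrow>
      \<exists>(r :: nat \<Rightarrow> nat) F. strict_mono r \<and> F \<in> \<A> \<and> I F \<le> liminf (\<lambda>j. I (E (r j))) \<and> (\<lambda>j. L (E (r j))) \<longlonglongrightarrow> L F"
  shows "\<exists>F\<in>\<A>. \<forall>E\<in>\<A>. enn2ereal (I F) + ereal (L F) \<le> enn2ereal (I E) + ereal (L E)"
proof -
  define c where "c E = enn2real (I E) + L E" for E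
  define S where "S = {E \<in> \<A>. I E < \<infinity>}"
  define v where "v = (INF E\<in>S. c E)"
  have S: "S \<noteq> {}" using E0 by (auto simp: S_def)
  have bdd: "bdd_below (c ` S)"
    by (rule bdd_belowI[of _ "- B"]) (use low in \<open>force simp: S_def c_def intro: add_increasing\<close>)
  have v_le: "v \<le> c E" if "E \<in> S" for E
    unfolding v_def using bdd that by (rule cINF_lower)
  have "\<exists>E\<in>S. c E < v + 1 / real (Suc j)" for j
    using cINF_less_iff[OF S bdd, of "v + 1 / real (Suc j)"] unfolding v_def by simp
  then obtain E where E: "\<And>j. E j \<in> S" "\<And>j. c (E j) < v + 1 / real (Suc j)" by metis
  have I_le: "I (E j) \<le> ennreal (v + 1 / real (Suc j) - L (E j))" for j
  proof -
    have "I (E j) = ennreal (enn2real (I (E j)))" using E(1)[of j] by (simp add: S_def)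
    also have "\<dots> \<le> ennreal (v + 1 / real (Suc j) - L (E j))"
      using E(2)[of j] by (intro ennreal_leI) (simp add: c_def)
    finally show ?thesis .
  qed
  have "I (E j) \<le> ennreal (v + 1 + B)" for j
  proof -
    have "1 / real (Suc j) \<le> 1" by simp
    then have "v + 1 / real (Suc j) - L (E j) \<le> v + 1 + B"
      using low[of "E j"] E(1)[of j] unfolding S_def mem_Collect_eq by linarith
    from order_trans[OF I_le ennreal_leI[OF this]] show ?thesis .
  qed
  with compact[of E] E(1) obtain r F where r: "strict_mono (r :: nat \<Rightarrow> nat)" and F: "F \<in> \<A>"
    and lsc: "I F \<le> liminf (\<lambda>j. I (E (r j)))" and LF: "(\<lambda>j. L (E (r j))) \<longlonglongrightarrow> L F"
    unfolding S_def by blast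
  \<comment> \<open>By the choice of the sequence, \<open>b j\<close> bounds \<open>I (E (r j))\<close> from above, and it converges to
    \<open>v - L F\<close>.\<close>
  define b where "b j = v + 1 / real (Suc (r j)) - L (E (r j))" for j
  have "(\<lambda>j. 1 / real (Suc (r j))) \<longlonglongrightarrow> 0"
    using LIMSEQ_subseq_LIMSEQ[OF LIMSEQ_inverse_real_of_nat r] by (simp add: o_def inverse_eq_divide)
  from tendsto_diff[OF tendsto_add[OF tendsto_const this] LF]
  have b: "b \<longlonglongrightarrow> v - L F" unfolding b_def by simp
  have "0 \<le> b j" for j
    using E(2)[of "r j"] enn2real_nonneg[of "I (E (r j))"] unfolding b_def c_def by linarith
  then have nn: "0 \<le> v - L F" using b by (intro LIMSEQ_le_const[OF b]) auto
  have "liminf (\<lambda>j. I (E (r j))) \<le> liminf (\<lambda>j. ennreal (b j))"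
    by (intro Liminf_mono always_eventually) (use I_le in \<open>auto simp: b_def\<close>)
  also have "\<dots> = ennreal (v - L F)"
    by (intro lim_imp_Liminf tendsto_ennrealI b) simp
  finally have I_F: "I F \<le> ennreal (v - L F)" using lsc by (rule order_trans[rotated])
  then have "enn2ereal (I F) \<le> ereal (v - L F)"
    using nn by (metis enn2ereal_ennreal less_eq_ennreal.rep_eq)
  then have F_le: "enn2ereal (I F) + ereal (L F) \<le> ereal v"
    using add_right_mono[of "enn2ereal (I F)" "ereal (v - L F)" "ereal (L F)"] by simp
  show ?thesis
  proof (rule bexI[OF _ F], rule ballI)
    fix E' assume E': "E' \<in> \<A>"
    show "enn2ereal (I F) + ereal (L F) \<le> enn2ereal (I E') + ereal (L E')"
    proof (cases "I E'" rule: ennreal_cases)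
      case (real a)
      then have "v \<le> a + L E'" using v_le[of E'] E' by (simp add: S_def c_def)
      then have "ereal v \<le> enn2ereal (I E') + ereal (L E')" using real by (simp add: enn2ereal_ennreal)
      with F_le show ?thesis by (rule order_trans)
    qed simp
  qed
qed

section \<open>Existence of minimizers of the capillarity functional\<close>

lemma L_infinity_imp_set_integrable:
  fixes g :: "real^'n \<Rightarrow> real"
  assumes g: "g \<in> L_infinity \<Omega>" and \<Omega>: "\<Omega> \<in> sets lebesgue" "emeasure lebesgue \<Omega> < \<infinity>"
  shows "set_integrable lebesgue \<Omega> g"
proof -
  obtain M where meas: "g \<in> borel_measurable (lebesgue_on \<Omega>)" and M: "AE x in lebesgue_on \<Omega>. \<bar>g x\<bar> \<le> M"
    using g by (auto simp: L_infinity_def)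
  have "AE x in lebesgue. x \<in> \<Omega> \<longrightarrow> \<bar>g x\<bar> \<le> M"
    using M \<Omega>(1) by (simp add: AE_restrict_space_iff)
  then have bd: "AE x in lebesgue. norm (indicator \<Omega> x *\<^sub>R g x) \<le> norm (M * indicator \<Omega> x)"
    by eventually_elim (auto simp: indicator_def)
  have m: "(\<lambda>x. indicator \<Omega> x *\<^sub>R g x) \<in> borel_measurable lebesgue"
    using meas \<Omega>(1) by (simp add: borel_measurable_restrict_space_iff)
  have i: "integrable lebesgue (\<lambda>x. M * indicator \<Omega> x)"
    using \<Omega> by (intro integrable_mult_right) (simp add: integrable_indicator_iff)
  show ?thesis
    unfolding set_integrable_def by (rule Bochner_Integration.integrable_bound[OF i m bd])
qed

text \<open>All three terms of the functional only see \<open>E\<close> up to a null set, so \<open>E\<close> may be replaced by a Borel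
  set.  The finite second interaction and the potential term are collected in one real number.\<close>

lemma capillarity_functional_eq_borel:
  fixes K1 K2 g :: "real ^ 'n \<Rightarrow> real"
  assumes k1: "AE z in lborel. ennreal (K1 z) = k1 z" and k2: "AE z in lborel. ennreal (K2 z) = k2 z"
    and g: "set_integrable lebesgue \<Omega> g"
    and E: "E \<in> sets lebesgue" "E \<subseteq> \<Omega>" and E': "E' \<in> sets borel" "E' \<subseteq> \<Omega>"
    and ae: "AE x in lborel. x \<in> E \<longleftrightarrow> x \<in> E'"
    and fin: "nonlocal_energy k2 \<Omega> (- \<Omega>) < \<infinity>"
  shows "capillarity_functional K1 K2 \<sigma> g \<Omega> E =
    enn2ereal (nonlocal_energy k1 E' (\<Omega> - E')) +
    ereal (\<sigma> * enn2real (nonlocal_energy k2 E' (- \<Omega>)) + (LINT x:E'|lebesgue. g x))"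
proof -
  have 1: "interaction K1 E (- E \<inter> \<Omega>) = nonlocal_energy k1 E' (\<Omega> - E')"
    by (rule interaction_eq_nonlocal_energy[OF k1 ae]) (use ae in eventually_elim, auto)
  have 2: "interaction K2 E (- \<Omega>) = nonlocal_energy k2 E' (- \<Omega>)"
    by (rule interaction_eq_nonlocal_energy[OF k2 ae]) simp
  have "nonlocal_energy k2 E' (- \<Omega>) < \<infinity>"
    using nonlocal_energy_mono[OF E'(2) order_refl, of k2 "- \<Omega>"] fin by (rule le_less_trans)
  then have 3: "enn2ereal (nonlocal_energy k2 E' (- \<Omega>)) = ereal (enn2real (nonlocal_energy k2 E' (- \<Omega>)))"
    by (cases "nonlocal_energy k2 E' (- \<Omega>)" rule: ennreal_cases) (auto simp: enn2ereal_ennreal)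
  have 4: "(LINT x:E|lebesgue. g x) = (LINT x:E'|lebesgue. g x)"
    unfolding set_lebesgue_integral_def
  proof (rule integral_cong_AE)
    have "set_integrable lebesgue E g" "set_integrable lebesgue E' g"
      using set_integrable_subset[OF g] E E' by auto
    then show "(\<lambda>x. indicator E x *\<^sub>R g x) \<in> borel_measurable lebesgue"
      "(\<lambda>x. indicator E' x *\<^sub>R g x) \<in> borel_measurable lebesgue"
      by (auto simp: set_integrable_def dest: borel_measurable_integrable)
    show "AE x in lebesgue. indicator E x *\<^sub>R g x = indicator E' x *\<^sub>R g x"
      using AE_completion[OF ae] by eventually_elim (auto simp: indicator_def)
  qed
  show ?thesis
    unfolding capillarity_functional_def capillarity_energy_def 1 2 3 4
    by (simp add: add.assoc)
qed

theorem proposition1p1: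
  fixes K1 K2 g :: "real ^ 'n \<Rightarrow> real"
    and \<Omega> :: "(real ^ 'n) set"
    and s1 s2 lam \<sigma> m :: real
    and \<rho> :: ereal
  assumes "CARD('n) \<ge> 2"
    and "s1 \<in> {0<..<1}" and "s2 \<in> {0<..<1}"
    and "lam \<ge> 1" and "\<rho> > 0"
    and "K1 \<in> kernel_class s1 lam \<rho>" and "K2 \<in> kernel_class s2 lam \<rho>"
    and "open \<Omega>" and "bounded \<Omega>"
    and "interaction K1 \<Omega> (- \<Omega>) + interaction K2 \<Omega> (- \<Omega>) < \<infinity>"
    and "0 < m" and "m < measure lebesgue \<Omega>"
    and "g \<in> L_infinity \<Omega>"
  shows "(\<exists>E. is_volume_minimizer (capillarity_functional K1 K2 \<sigma> g \<Omega>) \<Omega> m E) \<and>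
         (\<forall>E. is_volume_minimizer (capillarity_functional K1 K2 \<sigma> g \<Omega>) \<Omega> m E \<longrightarrow>
              interaction K1 E (- E \<inter> \<Omega>) < \<infinity>)"
proof -
  from kernel_class_borel_representative[OF \<open>K1 \<in> kernel_class s1 lam \<rho>\<close> \<open>lam \<ge> 1\<close>]
  obtain k1 where k1 [measurable]: "k1 \<in> borel_measurable borel" and ae1: "AE z in lborel. ennreal (K1 z) = k1 z"
    and up1: "\<And>z. k1 z \<le> ennreal (lam / norm z powr (real CARD('n) + s1))"
    and lo1: "\<And>z. ereal (norm z) < \<rho> \<Longrightarrow> ennreal (1 / (lam * norm z powr (real CARD('n) + s1))) \<le> k1 z"
    by blast
  obtain k2 where k2 [measurable]: "k2 \<in> borel_measurable borel" and ae2: "AE z in lborel. ennreal (K2 z) = k2 z"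
    by (rule kernel_class_borel_representative[OF \<open>K2 \<in> kernel_class s2 lam \<rho>\<close> \<open>lam \<ge> 1\<close>], rule that)
  have \<Omega> [measurable]: "\<Omega> \<in> sets borel" using \<open>open \<Omega>\<close> by simp
  obtain R where R: "R > 0" "\<Omega> \<subseteq> cball 0 R"
    using \<open>bounded \<Omega>\<close> bounded_subset_ballD[of \<Omega> 0] ball_subset_cball by blast
  have \<Omega>_fin: "emeasure lborel \<Omega> < \<infinity>"
    using emeasure_mono[OF R(2), of lborel] emeasure_lborel_cball_finite[of 0 R] by (auto intro: le_less_trans)
  have "interaction K1 \<Omega> (- \<Omega>) = nonlocal_energy k1 \<Omega> (- \<Omega>)"
    "interaction K2 \<Omega> (- \<Omega>) = nonlocal_energy k2 \<Omega> (- \<Omega>)"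
    using ae1 ae2 by (auto intro!: interaction_eq_nonlocal_energy)
  then have fin1: "nonlocal_energy k1 \<Omega> (- \<Omega>) < \<infinity>" and fin2: "nonlocal_energy k2 \<Omega> (- \<Omega>) < \<infinity>"
    using assms(10) by (auto simp: less_top)
  have g: "set_integrable lebesgue \<Omega> g"
    using \<open>g \<in> L_infinity \<Omega>\<close> \<Omega>_fin by (intro L_infinity_imp_set_integrable) auto
  define J where "J = capillarity_functional K1 K2 \<sigma> g \<Omega>"
  define \<A> where "\<A> = {E. E \<in> sets borel \<and> E \<subseteq> \<Omega> \<and> emeasure lborel E = ennreal m}"
  define I where "I E = nonlocal_energy k1 E (\<Omega> - E)" for E
  define L where "L E = \<sigma> * enn2real (nonlocal_energy k2 E (- \<Omega>)) + (LINT x:E|lebesgue. g x)" for E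
  have J_eq: "J E = enn2ereal (I E') + ereal (L E')"
    if "E \<in> sets lebesgue" "E \<subseteq> \<Omega>" "E' \<in> sets borel" "E' \<subseteq> \<Omega>" "AE x in lborel. x \<in> E \<longleftrightarrow> x \<in> E'" for E E'
    unfolding J_def I_def L_def by (rule capillarity_functional_eq_borel[OF ae1 ae2 g that fin2])
  have \<A>_adm: "E \<in> admissible_sets \<Omega> m" if "E \<in> \<A>" for E
    using that by (auto simp: \<A>_def admissible_sets_def)
  have J_\<A>: "J E = enn2ereal (I E) + ereal (L E)" if "E \<in> \<A>" for E
    using that by (intro J_eq) (auto simp: \<A>_def)
  \<comment> \<open>Every competitor has the same energy as its Borel part, which is again a competitor.\<close>
  have adm_\<A>: "\<exists>E'\<in>\<A>. J E = enn2ereal (I E') + ereal (L E')" if "E \<in> admissible_sets \<Omega> m" for E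
  proof -
    have E: "E \<in> sets lebesgue" "E \<subseteq> \<Omega>" "emeasure lebesgue E = ennreal m"
      using that by (auto simp: admissible_sets_def)
    let ?E = "main_part lborel E"
    have E': "?E \<in> sets borel" "?E \<subseteq> \<Omega>"
      using main_part_sets[OF E(1)] main_part_null_part_Un[OF E(1)] E(2) by auto
    moreover have "emeasure lborel ?E = ennreal m"
      using E by (simp add: emeasure_completion)
    moreover have "J E = enn2ereal (I ?E) + ereal (L ?E)"
      by (rule J_eq[OF E(1,2) E']) (use AE_in_main_part[OF E(1)] in auto)
    ultimately show ?thesis by (auto simp: \<A>_def)
  qed

  \<comment> \<open>The competitor of finite energy is a section of \<open>\<Omega>\<close> by a half-space.\<close>
  obtain E0 where E0: "E0 \<in> \<A>" "I E0 < \<infinity>"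
  proof -
    fix i :: 'n
    have "m < measure lborel \<Omega>" using \<open>m < measure lebesgue \<Omega>\<close> by simp
    from exists_halfspace_section_of_volume[OF \<Omega> \<open>bounded \<Omega>\<close> \<open>0 < m\<close> this]
    obtain t where t: "measure lborel {x \<in> \<Omega>. x $ i < t} = m" by blast
    let ?E = "{x \<in> \<Omega>. x $ i < t}"
    have "emeasure lborel ?E < \<infinity>"
      using emeasure_mono[of ?E \<Omega> lborel] \<Omega>_fin by (auto intro: le_less_trans)
    then have "emeasure lborel ?E = ennreal m"
      using t by (simp add: emeasure_eq_ennreal_measure)
    moreover have "?E \<in> sets borel" by measurable
    ultimately have "?E \<in> \<A>" by (auto simp: \<A>_def)
    moreover have "\<Omega> - ?E = {x \<in> \<Omega>. \<not> x $ i < t}" by auto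
    then have "I ?E < \<infinity>"
      using halfspace_energy_finite[OF k1 \<Omega> up1 _ _ _ R, of i t] assms(2,4) by (simp add: I_def)
    ultimately show ?thesis by (rule that)
  qed

  have L_low: "- (\<bar>\<sigma>\<bar> * enn2real (nonlocal_energy k2 \<Omega> (- \<Omega>)) + (LINT x:\<Omega>|lebesgue. \<bar>g x\<bar>)) \<le> L E" if "E \<in> \<A>" for E
  proof -
    have E: "E \<in> sets borel" "E \<subseteq> \<Omega>" using that by (auto simp: \<A>_def)
    have "enn2real (nonlocal_energy k2 E (- \<Omega>)) \<le> enn2real (nonlocal_energy k2 \<Omega> (- \<Omega>))"
      using nonlocal_energy_mono[OF E(2) order_refl, of k2 "- \<Omega>"] fin2 by (intro enn2real_mono) auto
    then have "\<bar>\<sigma> * enn2real (nonlocal_energy k2 E (- \<Omega>))\<bar> \<le> \<bar>\<sigma>\<bar> * enn2real (nonlocal_energy k2 \<Omega> (- \<Omega>))"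
      by (simp add: abs_mult mult_left_mono)
    moreover have "\<bar>LINT x:E|lebesgue. g x\<bar> \<le> (LINT x:\<Omega>|lebesgue. \<bar>g x\<bar>)"
      using E g by (intro abs_set_integral_le) auto
    ultimately show ?thesis unfolding L_def by linarith
  qed

  have compact: "\<exists>(r :: nat \<Rightarrow> nat) F. strict_mono r \<and> F \<in> \<A> \<and> I F \<le> liminf (\<lambda>j. I (E (r j))) \<and> (\<lambda>j. L (E (r j))) \<longlonglongrightarrow> L F"
    if E: "\<And>j. E j \<in> \<A>" and bd: "\<And>j. I (E j) \<le> ennreal C" for E :: "nat \<Rightarrow> (real^'n) set" and C
  proof -
    have Eb [measurable]: "E j \<in> sets borel" and E_sub: "E j \<subseteq> \<Omega>" and Em: "emeasure lborel (E j) = ennreal m" for j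
      using E[of j] by (auto simp: \<A>_def)
    \<comment> \<open>Adding the interaction of \<open>\<Omega>\<close> with its complement turns the energy bound into a bound on the
      nonlocal perimeter in the whole space.\<close>
    define C' where "C' = max C 0 + enn2real (nonlocal_energy k1 \<Omega> (- \<Omega>))"
    have bd': "nonlocal_energy k1 (E j) (- E j) \<le> ennreal C'" for j
    proof -
      have "- E j = (\<Omega> - E j) \<union> (- \<Omega>)" using E_sub[of j] by auto
      then have "nonlocal_energy k1 (E j) (- E j) = I (E j) + nonlocal_energy k1 (E j) (- \<Omega>)"
        using nonlocal_energy_Un_right[OF k1 Eb[of j], of "\<Omega> - E j" "- \<Omega>"] by (auto simp: I_def)
      also have "\<dots> \<le> ennreal (max C 0) + nonlocal_energy k1 \<Omega> (- \<Omega>)"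
        using order_trans[OF bd[of j], of "ennreal (max C 0)"] E_sub
        by (intro add_mono nonlocal_energy_mono) (auto intro: ennreal_leI)
      also have "\<dots> = ennreal C'"
        using fin1 by (simp add: C'_def ennreal_plus)
      finally show ?thesis .
    qed
    obtain r F where r: "strict_mono (r :: nat \<Rightarrow> nat)" and F [measurable]: "F \<in> sets borel" and F_sub: "F \<subseteq> \<Omega>"
      and ae: "AE x in lborel. \<forall>\<^sub>F j in sequentially. x \<in> E (r j) \<longleftrightarrow> x \<in> F"
      using assms(2,4)
      by (auto intro: finite_nonlocal_energy_compactness[where E = E, OF k1 lo1 \<open>\<rho> > 0\<close> _ _ Eb \<open>bounded \<Omega>\<close> E_sub bd'])
    have "(\<lambda>j. emeasure lborel (E (r j))) \<longlonglongrightarrow> emeasure lborel F"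
      by (rule emeasure_tendsto_of_eventually[where A = "\<lambda>j. E (r j)", OF _ _ _ ae E_sub \<Omega>_fin]) auto
    then have "emeasure lborel F = ennreal m"
      using Em by (simp add: LIMSEQ_const_iff)
    then have "F \<in> \<A>" using F F_sub by (simp add: \<A>_def)
    moreover have "I F \<le> liminf (\<lambda>j. I (E (r j)))"
      unfolding I_def
      by (rule nonlocal_energy_lower_semicontinuous[OF k1 _ _ ae])
        (measurable, use ae in eventually_elim, auto elim!: eventually_mono)
    moreover have "(\<lambda>j. L (E (r j))) \<longlonglongrightarrow> L F"
    proof -
      have "(\<lambda>j. nonlocal_energy k2 (E (r j)) (- \<Omega>)) \<longlonglongrightarrow> nonlocal_energy k2 F (- \<Omega>)"
        by (rule nonlocal_energy_tendsto[where A = "\<lambda>j. E (r j)", OF k2 _ _ _ _ ae E_sub fin2]) auto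
      moreover have "nonlocal_energy k2 F (- \<Omega>) < \<infinity>"
        using nonlocal_energy_mono[OF F_sub order_refl, of k2 "- \<Omega>"] fin2 by (rule le_less_trans)
      ultimately have "(\<lambda>j. enn2real (nonlocal_energy k2 (E (r j)) (- \<Omega>))) \<longlonglongrightarrow> enn2real (nonlocal_energy k2 F (- \<Omega>))"
        by (intro tendsto_enn2real) auto
      moreover have "(\<lambda>j. LINT x:E (r j)|lebesgue. g x) \<longlonglongrightarrow> (LINT x:F|lebesgue. g x)"
        by (rule set_integral_tendsto_of_eventually[where A = "\<lambda>j. E (r j)", OF _ _ g AE_completion[OF ae] E_sub F_sub]) auto
      ultimately show ?thesis unfolding L_def by (intro tendsto_add tendsto_mult tendsto_const)
    qed
    ultimately show ?thesis using r by blast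
  qed

  have "\<exists>F\<in>\<A>. \<forall>E\<in>\<A>. enn2ereal (I F) + ereal (L F) \<le> enn2ereal (I E) + ereal (L E)"
    by (rule direct_method[where I = I and L = L], rule E0(1), rule E0(2), rule L_low, assumption, rule compact)
  then obtain F where F: "F \<in> \<A>"
    and min: "\<And>E. E \<in> \<A> \<Longrightarrow> enn2ereal (I F) + ereal (L F) \<le> enn2ereal (I E) + ereal (L E)"
    by blast
  have "is_volume_minimizer J \<Omega> m F"
    unfolding is_volume_minimizer_def
  proof (intro conjI ballI)
    show "F \<in> admissible_sets \<Omega> m" by (rule \<A>_adm[OF F])
    fix G assume "G \<in> admissible_sets \<Omega> m"
    from adm_\<A>[OF this] obtain G' where "G' \<in> \<A>" "J G = enn2ereal (I G') + ereal (L G')" by blast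
    then show "J F \<le> J G" using min[of G'] J_\<A>[OF F] by simp
  qed
  \<comment> \<open>An infinite first interaction makes \<open>J E\<close> infinite, whereas \<open>J E0\<close> is finite.\<close>
  moreover have "interaction K1 E (- E \<inter> \<Omega>) < \<infinity>" if "is_volume_minimizer J \<Omega> m E" for E
  proof (rule ccontr)
    assume "\<not> interaction K1 E (- E \<inter> \<Omega>) < \<infinity>"
    then have inf: "interaction K1 E (- E \<inter> \<Omega>) = \<infinity>" by (simp add: not_less top_unique)
    have E: "E \<in> admissible_sets \<Omega> m" "J E \<le> J E0"
      using that \<A>_adm[OF E0(1)] by (auto simp: is_volume_minimizer_def)
    have "J E0 < \<infinity>"
      using J_\<A>[OF E0(1)] E0(2) by (cases "I E0" rule: ennreal_cases) (auto simp: enn2ereal_ennreal)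
    moreover have "interaction K2 E (- \<Omega>) \<le> interaction K2 \<Omega> (- \<Omega>)"
      unfolding interaction_def using E(1)
      by (intro nn_integral_mono mult_left_mono) (auto simp: admissible_sets_def indicator_def)
    then have "interaction K2 E (- \<Omega>) < \<infinity>"
      using assms(10) by (auto simp: less_top top_unique)
    then have "J E = \<infinity>"
      unfolding J_def capillarity_functional_def capillarity_energy_def inf
      by (cases "interaction K2 E (- \<Omega>)" rule: ennreal_cases) (auto simp: enn2ereal_ennreal)
    ultimately show False using E(2) by simp
  qed
  ultimately show ?thesis unfolding J_def by blast
qed

end
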